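(* Let $\xi=(\xi(k))_{k\ge 0}$ be a discrete-time stationary $\mathbb{R}^d$-valued process with $\mathbf{E}\,\xi(0)=0$, with finite second moments and summable correlations; that is, with $\Delta(n):=\mathbf{E}(\xi(0)\otimes\xi(n))$ for $n=0,1,2,\dots$, $\Delta(0)$ and $\sum_{n=1}^{\infty}\Delta(n)$ are finite. Let $\hat S_N$ be the rescaled piecewise linear partial sum process of $\xi$ and let \[ \hat{\mathbb{S}}_N(t)=\int_0^t\hat S_N(s)\otimes\mathrm{d}\hat S_N(s) \] (Riemann--Stieltjes integral) be its canonical lift. If the iterated invariance principle holds for $(\hat S_N,\hat{\mathbb{S}}_N)$ with a Brownian rough path limit $(B,\hat{\mathbb{B}})$ over $\mathbb{R}^d$, then $(B,\hat{\mathbb{B}})$ has characteristics $(\Sigma,\hat\Gamma)$ given by \[ \Sigma=\Delta(0)+2\,\mathrm{Sym}\Big(\sum_{n=1}^{\infty}\Delta(n)\Big),\qquad \hat\Gamma=\frac12\Delta(0)+\sum_{n=1}^{\infty}\Delta(n). \] As a consequence, \[ \hat{\mathbb{B}}(1)=\int_0^1B\otimes\circ\,\mathrm{d}B+\mathrm{Anti}\Big(\sum_{n=1}^{\infty}\Delta(n)\Big), \] where the last integral is in the sense of Stratonovich.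
   Context: Conventions: $(x\otimes y)^{i,j}=x^iy^j$ for $x,y\in\mathbb{R}^d$; $(\mathbb{R}^d)^{\otimes 2}$ is identified with $d\times d$ matrices; expectations of random vectors and matrices are taken component-wise; $\mathrm{Sym}(M)=\frac12(M+M^T)$ and $\mathrm{Anti}(M)=\frac12(M-M^T)$ are the symmetric and antisymmetric parts of $M$; $[x]$ is the integer part of $x$. Piecewise linear partial sums: $\hat S_N$ is the continuous process that agrees with $S_N(t)=N^{-1/2}\sum_{0\le k<[Nt]}\xi(k)$ at the grid points $t=k/N$, $k=0,1,2,\dots$, and is linear on each interval $[k/N,(k+1)/N]$; that is, $\hat S_N(t)=N^{-1/2}\big(\sum_{0\le k<[Nt]}\xi(k)+(Nt-[Nt])\,\xi([Nt])\big)$. Brownian rough path: a Brownian rough path over $\mathbb{R}^d$ with characteristics $(\Sigma,\Gamma)\in(\mathbb{R}^d)^{\otimes2}\times(\mathbb{R}^d)^{\otimes2}$ is any process $t\mapsto(B(t),\mathbb{B}(t))$, where $B$ is a $d$-dimensional Brownian motion with covariance $\Sigma=\mathbf{E}(B(1)\otimes B(1))$ and $\mathbb{B}(t)=\int_0^tB\otimes\mathrm{d}B+t\Gamma$, i.e. $\mathbb{B}^{i,j}(t)=\int_0^tB^i(s)\,\mathrm{d}B^j(s)+t\,\Gamma^{i,j}$, with the integral in the sense of Itô. In particular $\Gamma=\mathbf{E}(\mathbb{B}(1))$. Iterated invariance principle: let $t\mapsto(S_N(t),\mathbb{S}_N(t))$, $N\ge1$, be random processes on $\mathbb{R}^d\times(\mathbb{R}^d)^{\otimes2}$.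 The iterated invariance principle holds for $(S_N,\mathbb{S}_N)$ with Brownian rough path limit $(B,\mathbb{B})$ if (1) for all $t$, the sequence $(S_N(t),\mathbb{S}_N(t))$ converges in law to $(B(t),\mathbb{B}(t))$ as $N\to\infty$; and (2) $\mathbf{E}(S_N(1)\otimes S_N(1))\to\mathbf{E}(B(1)\otimes B(1))$ and $\mathbf{E}(\mathbb{S}_N(1))\to\mathbf{E}(\mathbb{B}(1))$. *)

theory Defs
  imports "HOL-Probability.Probability"
begin

section \<open>Vectors, matrices and partitions\<close>

definition outer :: "real ^ 'd \<Rightarrow> real ^ 'd \<Rightarrow> real ^ 'd ^ 'd"  (infixl "\<otimes>\<^sub>v" 75)
  where "x \<otimes>\<^sub>v y = (\<chi> i j. x $ i * y $ j)"

definition sym_part :: "real ^ 'd ^ 'd \<Rightarrow> real ^ 'd ^ 'd"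
  where "sym_part A = (1/2) *\<^sub>R (A + transpose A)"

definition anti_part :: "real ^ 'd ^ 'd \<Rightarrow> real ^ 'd ^ 'd"
  where "anti_part A = (1/2) *\<^sub>R (A - transpose A)"

text \<open>The points \<open>\<tau> 0 < \<dots> < \<tau> n\<close> of a partition of \<open>[a,b]\<close>; values of \<open>\<tau>\<close> beyond \<open>n\<close> are
  irrelevant.\<close>

definition is_partition :: "real \<Rightarrow> real \<Rightarrow> nat \<Rightarrow> (nat \<Rightarrow> real) \<Rightarrow> bool"
  where "is_partition a b n \<tau> \<longleftrightarrow> \<tau> 0 = a \<and> \<tau> n = b \<and> (\<forall>k<n. \<tau> k < \<tau> (Suc k))"

definition mesh_less :: "real \<Rightarrow> nat \<Rightarrow> (nat \<Rightarrow> real) \<Rightarrow> bool"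
  where "mesh_less \<delta> n \<tau> \<longleftrightarrow> (\<forall>k<n. \<tau> (Suc k) - \<tau> k < \<delta>)"

section \<open>Riemann--Stieltjes integral\<close>

definition has_rs_integral ::
    "real \<Rightarrow> real \<Rightarrow> (real \<Rightarrow> real) \<Rightarrow> (real \<Rightarrow> real) \<Rightarrow> real \<Rightarrow> bool"
  where "has_rs_integral a b f g I \<longleftrightarrow>
    (\<forall>\<epsilon>>0. \<exists>\<delta>>0. \<forall>n \<tau> c.
       is_partition a b n \<tau> \<and> mesh_less \<delta> n \<tau> \<and> (\<forall>k<n. c k \<in> {\<tau> k..\<tau> (Suc k)}) \<longrightarrow>
       \<bar>(\<Sum>k<n. f (c k) * (g (\<tau> (Suc k)) - g (\<tau> k))) - I\<bar> < \<epsilon>)"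

definition rs_integral :: "real \<Rightarrow> real \<Rightarrow> (real \<Rightarrow> real) \<Rightarrow> (real \<Rightarrow> real) \<Rightarrow> real"
  where "rs_integral a b f g = (THE I. has_rs_integral a b f g I)"

section \<open>Brownian motion\<close>

text \<open>Centred normal law of variance \<open>v\<close>, including the Dirac mass at \<open>0\<close> for \<open>v = 0\<close>.\<close>

definition centred_normal :: "'b measure \<Rightarrow> real \<Rightarrow> ('b \<Rightarrow> real) \<Rightarrow> bool"
  where "centred_normal P v X \<longleftrightarrow>
    (v > 0 \<and> distributed P lborel X (normal_density 0 (sqrt v))) \<or>
    (v = 0 \<and> X \<in> borel_measurable P \<and> (AE \<omega> in P. X \<omega> = 0))"

text \<open>A possibly degenerate Gaussian vector: every linear functional is normally distributed.
  Symmetry of \<open>C\<close> is required separately, because the quadratic form of \<open>C\<close> does not see its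
  antisymmetric part.\<close>

definition centred_gaussian :: "'b measure \<Rightarrow> real ^ 'd ^ 'd \<Rightarrow> ('b \<Rightarrow> real ^ 'd) \<Rightarrow> bool"
  where "centred_gaussian P C X \<longleftrightarrow>
    X \<in> borel_measurable P \<and> transpose C = C \<and>
    (\<forall>u. centred_normal P (u \<bullet> (C *v u)) (\<lambda>\<omega>. u \<bullet> X \<omega>))"

definition nat_filtration ::
    "'b measure \<Rightarrow> (real \<Rightarrow> 'b \<Rightarrow> 'x::topological_space) \<Rightarrow> real \<Rightarrow> 'b measure"
  where "nat_filtration P B t =
    sigma (space P) {B s -` A \<inter> space P | s A. 0 \<le> s \<and> s \<le> t \<and> A \<in> sets borel}"

text \<open>Processes in continuous time are indexed by \<open>real\<close>; only times \<open>t \<ge> 0\<close> matter.\<close>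

definition brownian_motion ::
    "'b measure \<Rightarrow> real ^ 'd ^ 'd \<Rightarrow> (real \<Rightarrow> 'b \<Rightarrow> real ^ 'd) \<Rightarrow> bool"
  where "brownian_motion P C B \<longleftrightarrow>
    prob_space P \<and>
    (\<forall>t\<ge>0. B t \<in> borel_measurable P) \<and>
    (AE \<omega> in P. B 0 \<omega> = 0) \<and>
    (AE \<omega> in P. continuous_on {0..} (\<lambda>t. B t \<omega>)) \<and>
    (\<forall>s t. 0 \<le> s \<and> s \<le> t \<longrightarrow>
       centred_gaussian P ((t - s) *\<^sub>R C) (\<lambda>\<omega>. B t \<omega> - B s \<omega>) \<and>
       prob_space.indep_set P (sets (nat_filtration P B s))
         {(\<lambda>\<omega>. B t \<omega> - B s \<omega>) -` A \<inter> space P | A. A \<in> sets borel})"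

section \<open>Stochastic integrals\<close>

text \<open>Elementary processes \<open>\<Sum>k<n. \<phi> k * 1_(\<tau> k, \<tau> (k+1)]\<close> on \<open>[0,t]\<close>, where each \<open>\<phi> k\<close> is
  square integrable and measurable at the left endpoint.\<close>

definition elementary_process ::
    "'b measure \<Rightarrow> (real \<Rightarrow> 'b measure) \<Rightarrow> real \<Rightarrow> nat \<Rightarrow> (nat \<Rightarrow> real) \<Rightarrow> (nat \<Rightarrow> 'b \<Rightarrow> real) \<Rightarrow> bool"
  where "elementary_process P F t n \<tau> \<phi> \<longleftrightarrow>
    is_partition 0 t n \<tau> \<and>
    (\<forall>k<n. \<phi> k \<in> borel_measurable (F (\<tau> k)) \<and> integrable P (\<lambda>\<omega>. (\<phi> k \<omega>)\<^sup>2))"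

definition elementary_val ::
    "nat \<Rightarrow> (nat \<Rightarrow> real) \<Rightarrow> (nat \<Rightarrow> 'b \<Rightarrow> real) \<Rightarrow> real \<Rightarrow> 'b \<Rightarrow> real"
  where "elementary_val n \<tau> \<phi> s \<omega> = (\<Sum>k<n. \<phi> k \<omega> * indicator {\<tau> k<..\<tau> (Suc k)} s)"

definition elementary_ito ::
    "(real \<Rightarrow> 'b \<Rightarrow> real) \<Rightarrow> nat \<Rightarrow> (nat \<Rightarrow> real) \<Rightarrow> (nat \<Rightarrow> 'b \<Rightarrow> real) \<Rightarrow> 'b \<Rightarrow> real"
  where "elementary_ito W n \<tau> \<phi> \<omega> = (\<Sum>k<n. \<phi> k \<omega> * (W (\<tau> (Suc k)) \<omega> - W (\<tau> k) \<omega>))"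

text \<open>Adapted, jointly measurable and square integrable on \<open>[0,t]\<close>.\<close>

definition ito_integrand ::
    "'b measure \<Rightarrow> (real \<Rightarrow> 'b measure) \<Rightarrow> real \<Rightarrow> (real \<Rightarrow> 'b \<Rightarrow> real) \<Rightarrow> bool"
  where "ito_integrand P F t H \<longleftrightarrow>
    (\<forall>s\<in>{0..t}. H s \<in> borel_measurable (F s)) \<and>
    (\<lambda>(s, \<omega>). H s \<omega>) \<in> borel_measurable (restrict_space borel {0..t} \<Otimes>\<^sub>M P) \<and>
    (\<integral>\<^sup>+ \<omega>. (\<integral>\<^sup>+ s\<in>{0..t}. ennreal ((H s \<omega>)\<^sup>2) \<partial>lborel) \<partial>P) < \<infinity>"

text \<open>\<open>I\<close> is (a version of) the Ito integral of \<open>H\<close> over \<open>[0,t]\<close> with respect to \<open>W\<close>: the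
  \<open>L\<^sup>2\<close>-limit of integrals of elementary processes that approximate \<open>H\<close> in \<open>L\<^sup>2(ds \<times> dP)\<close>.
  Meant for \<open>W\<close> a (scaled) Brownian motion relative to \<open>F\<close>, where the Ito isometry makes \<open>I\<close>
  unique up to null sets.\<close>

definition has_ito_integral ::
    "'b measure \<Rightarrow> (real \<Rightarrow> 'b measure) \<Rightarrow> real \<Rightarrow> (real \<Rightarrow> 'b \<Rightarrow> real) \<Rightarrow> (real \<Rightarrow> 'b \<Rightarrow> real) \<Rightarrow>
      ('b \<Rightarrow> real) \<Rightarrow> bool"
  where "has_ito_integral P F t H W I \<longleftrightarrow>
    ito_integrand P F t H \<and> I \<in> borel_measurable P \<and>
    (\<exists>n \<tau> \<phi>. (\<forall>m. elementary_process P F t (n m) (\<tau> m) (\<phi> m)) \<and>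
       (\<lambda>m. \<integral>\<^sup>+ \<omega>. (\<integral>\<^sup>+ s\<in>{0..t}.
              ennreal ((H s \<omega> - elementary_val (n m) (\<tau> m) (\<phi> m) s \<omega>)\<^sup>2) \<partial>lborel) \<partial>P)
         \<longlonglongrightarrow> 0 \<and>
       (\<lambda>m. \<integral>\<^sup>+ \<omega>. ennreal ((I \<omega> - elementary_ito W (n m) (\<tau> m) (\<phi> m) \<omega>)\<^sup>2) \<partial>P)
         \<longlonglongrightarrow> 0)"

definition tendsto_in_prob :: "'b measure \<Rightarrow> (nat \<Rightarrow> 'b \<Rightarrow> real) \<Rightarrow> ('b \<Rightarrow> real) \<Rightarrow> bool"
  where "tendsto_in_prob P X Y \<longleftrightarrow>
    (\<forall>m. X m \<in> borel_measurable P) \<and> Y \<in> borel_measurable P \<and>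
    (\<forall>\<epsilon>>0. (\<lambda>m. measure P {\<omega> \<in> space P. \<bar>X m \<omega> - Y \<omega>\<bar> > \<epsilon>}) \<longlonglongrightarrow> 0)"

text \<open>Quadratic covariation of \<open>X\<close> and \<open>Y\<close> at time \<open>t\<close>.\<close>

definition has_covariation ::
    "'b measure \<Rightarrow> real \<Rightarrow> (real \<Rightarrow> 'b \<Rightarrow> real) \<Rightarrow> (real \<Rightarrow> 'b \<Rightarrow> real) \<Rightarrow> ('b \<Rightarrow> real) \<Rightarrow> bool"
  where "has_covariation P t X Y Q \<longleftrightarrow>
    (\<forall>n \<tau>. (\<forall>m. is_partition 0 t (n m) (\<tau> m)) \<and>
            (\<forall>\<delta>>0. \<forall>\<^sub>F m in sequentially. mesh_less \<delta> (n m) (\<tau> m)) \<longrightarrow>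
       tendsto_in_prob P
         (\<lambda>m \<omega>. \<Sum>k<n m. (X (\<tau> m (Suc k)) \<omega> - X (\<tau> m k) \<omega>) * (Y (\<tau> m (Suc k)) \<omega> - Y (\<tau> m k) \<omega>))
         Q)"

text \<open>The Stratonovich integral of \<open>H\<close> with respect to \<open>W\<close>, that is, the Ito integral plus half
  the covariation.\<close>

definition has_stratonovich_integral ::
    "'b measure \<Rightarrow> (real \<Rightarrow> 'b measure) \<Rightarrow> real \<Rightarrow> (real \<Rightarrow> 'b \<Rightarrow> real) \<Rightarrow> (real \<Rightarrow> 'b \<Rightarrow> real) \<Rightarrow>
      ('b \<Rightarrow> real) \<Rightarrow> bool"
  where "has_stratonovich_integral P F t H W I \<longleftrightarrow>
    I \<in> borel_measurable P \<and>
    (\<exists>J Q. has_ito_integral P F t H W J \<and> has_covariation P t H W Q \<and>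
       (AE \<omega> in P. I \<omega> = J \<omega> + Q \<omega> / 2))"

section \<open>Brownian rough paths and the iterated invariance principle\<close>

definition brownian_rough_path ::
    "'b measure \<Rightarrow> real ^ 'd ^ 'd \<Rightarrow> real ^ 'd ^ 'd \<Rightarrow>
      (real \<Rightarrow> 'b \<Rightarrow> real ^ 'd) \<Rightarrow> (real \<Rightarrow> 'b \<Rightarrow> real ^ 'd ^ 'd) \<Rightarrow> bool"
  where "brownian_rough_path P C \<Gamma> B BB \<longleftrightarrow>
    brownian_motion P C B \<and>
    (\<forall>t\<ge>0. BB t \<in> borel_measurable P) \<and>
    (AE \<omega> in P. continuous_on {0..} (\<lambda>t. BB t \<omega>)) \<and>
    (\<forall>t\<ge>0. \<forall>i j. has_ito_integral P (nat_filtration P B) t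
        (\<lambda>s \<omega>. B s \<omega> $ i) (\<lambda>s \<omega>. B s \<omega> $ j) (\<lambda>\<omega>. BB t \<omega> $ i $ j - t * \<Gamma> $ i $ j))"

definition converges_in_law ::
    "'a measure \<Rightarrow> (nat \<Rightarrow> 'a \<Rightarrow> 'x::topological_space) \<Rightarrow> 'b measure \<Rightarrow> ('b \<Rightarrow> 'x) \<Rightarrow> bool"
  where "converges_in_law M X P Y \<longleftrightarrow>
    (\<forall>f :: 'x \<Rightarrow> real. continuous_on UNIV f \<and> bounded (range f) \<longrightarrow>
       (\<lambda>N. \<integral>\<omega>. f (X N \<omega>) \<partial>M) \<longlonglongrightarrow> (\<integral>\<omega>. f (Y \<omega>) \<partial>P))"

text \<open>The integrability clauses say that the expectations in the moment conditions exist; for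
  integrable matrices the Bochner integral is the component-wise expectation.\<close>

definition iterated_invariance_principle ::
    "'a measure \<Rightarrow> (nat \<Rightarrow> real \<Rightarrow> 'a \<Rightarrow> real ^ 'd) \<Rightarrow> (nat \<Rightarrow> real \<Rightarrow> 'a \<Rightarrow> real ^ 'd ^ 'd) \<Rightarrow>
      'b measure \<Rightarrow> (real \<Rightarrow> 'b \<Rightarrow> real ^ 'd) \<Rightarrow> (real \<Rightarrow> 'b \<Rightarrow> real ^ 'd ^ 'd) \<Rightarrow> bool"
  where "iterated_invariance_principle M S SS P B BB \<longleftrightarrow>
    (\<forall>N\<ge>1. \<forall>t\<ge>0. S N t \<in> borel_measurable M \<and> SS N t \<in> borel_measurable M) \<and>
    (\<forall>t\<ge>0. converges_in_law M (\<lambda>N \<omega>. (S N t \<omega>, SS N t \<omega>)) P (\<lambda>\<omega>. (B t \<omega>, BB t \<omega>))) \<and>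
    (\<forall>N\<ge>1. integrable M (\<lambda>\<omega>. S N 1 \<omega> \<otimes>\<^sub>v S N 1 \<omega>) \<and> integrable M (SS N 1)) \<and>
    integrable P (\<lambda>\<omega>. B 1 \<omega> \<otimes>\<^sub>v B 1 \<omega>) \<and> integrable P (BB 1) \<and>
    (\<lambda>N. \<integral>\<omega>. S N 1 \<omega> \<otimes>\<^sub>v S N 1 \<omega> \<partial>M) \<longlonglongrightarrow> (\<integral>\<omega>. B 1 \<omega> \<otimes>\<^sub>v B 1 \<omega> \<partial>P) \<and>
    (\<lambda>N. \<integral>\<omega>. SS N 1 \<omega> \<partial>M) \<longlonglongrightarrow> (\<integral>\<omega>. BB 1 \<omega> \<partial>P)"

section \<open>Stationary sequences and their partial sums\<close>

definition stationary_process ::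
    "'a measure \<Rightarrow> (nat \<Rightarrow> 'a \<Rightarrow> 'x::topological_space) \<Rightarrow> bool"
  where "stationary_process M \<xi> \<longleftrightarrow>
    (\<forall>k. \<xi> k \<in> borel_measurable M) \<and>
    (\<forall>h. distr M (PiM UNIV (\<lambda>_. borel)) (\<lambda>\<omega> k. \<xi> (k + h) \<omega>) =
         distr M (PiM UNIV (\<lambda>_. borel)) (\<lambda>\<omega> k. \<xi> k \<omega>))"

definition correlation :: "'a measure \<Rightarrow> (nat \<Rightarrow> 'a \<Rightarrow> real ^ 'd) \<Rightarrow> nat \<Rightarrow> real ^ 'd ^ 'd"
  where "correlation M \<xi> n = (\<integral>\<omega>. \<xi> 0 \<omega> \<otimes>\<^sub>v \<xi> n \<omega> \<partial>M)"

definition linear_partial_sum ::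
    "(nat \<Rightarrow> 'a \<Rightarrow> real ^ 'd) \<Rightarrow> nat \<Rightarrow> real \<Rightarrow> 'a \<Rightarrow> real ^ 'd"
  where "linear_partial_sum \<xi> N t \<omega> =
    (1 / sqrt N) *\<^sub>R ((\<Sum>k<nat \<lfloor>N * t\<rfloor>. \<xi> k \<omega>) + frac (N * t) *\<^sub>R \<xi> (nat \<lfloor>N * t\<rfloor>) \<omega>)"

definition canonical_lift ::
    "(real \<Rightarrow> 'a \<Rightarrow> real ^ 'd) \<Rightarrow> real \<Rightarrow> 'a \<Rightarrow> real ^ 'd ^ 'd"
  where "canonical_lift S t \<omega> = (\<chi> i j. rs_integral 0 t (\<lambda>s. S s \<omega> $ i) (\<lambda>s. S s \<omega> $ j))"

end

theory Submission
  imports Defs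
begin

text \<open>
  The moment conditions of the iterated invariance principle determine the characteristics. On the
  limit side, a Brownian rough path with characteristics \<open>(C, \<Gamma>)\<close> satisfies \<open>E (B 1 \<otimes>\<^sub>v B 1) = C\<close> and
  \<open>E (BB 1) = \<Gamma>\<close>; the latter because Ito integrals with respect to Brownian motion are centred
  (\<open>brownian_motion_second_moment\<close>, \<open>brownian_rough_path_expectation\<close>). So it remains to compute the
  limits of the same two expectations for the partial sums.

  For the piecewise linear interpolation the lift at time \<open>1\<close> is an explicit double sum,
  \<open>N\<inverse> (\<Sum>k<l. \<xi> k \<otimes>\<^sub>v \<xi> l) + N\<inverse> (\<Sum>k. \<xi> k \<otimes>\<^sub>v \<xi> k) / 2\<close>: the half on the diagonal comes from integrating
  a linear piece against itself (\<open>canonical_lift_linear_partial_sum\<close>). By stationarity its expectation is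
  half of \<open>\<Delta>(0)\<close> plus the Cesaro mean of the partial sums of the series of the \<open>\<Delta>(n)\<close>, \<open>n \<ge> 1\<close>, and so it
  converges to \<open>\<Gamma> = \<Delta>(0) / 2 + (\<Sum>n\<ge>1. \<Delta>(n))\<close> (\<open>integral_canonical_lift_tendsto\<close>). The covariance
  requires no second computation: integration by parts shows that the outer square of the partial sum is the lift plus its transpose
  (\<open>outer_linear_partial_sum\<close>), whence \<open>C = \<Gamma> + \<Gamma>\<^sup>T\<close>.

  This relation also gives the last claim. The covariation of \<open>B\<close> at time \<open>1\<close> is \<open>C\<close>
  (\<open>brownian_motion_covariation\<close>), so passing from the Ito to the Stratonovich integral adds \<open>C / 2\<close>, the
  symmetric part of \<open>\<Gamma>\<close>, and leaves the antisymmetric part of \<open>\<Gamma>\<close> as the correction.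
\<close>

section \<open>Riemann--Stieltjes integrals from second-order increments\<close>

lemma partition_mono:
  assumes "is_partition a b n \<tau>" "i \<le> j" "j \<le> n"
  shows "\<tau> i \<le> \<tau> j"
  using assms(2,3)
proof (induction j rule: dec_induct)
  case (step k)
  then have "\<tau> k < \<tau> (Suc k)"
    using assms(1) by (simp add: is_partition_def)
  with step show ?case by simp
qed simp

lemma partition_in_interval:
  assumes "is_partition a b n \<tau>" "k \<le> n"
  shows "\<tau> k \<in> {a..b}"
  using partition_mono[OF assms(1), of 0 k] partition_mono[OF assms(1), of k n] assms
  by (auto simp: is_partition_def)

lemma partition_sum_increments:
  fixes f :: "real \<Rightarrow> real"
  assumes "is_partition a b n \<tau>"
  shows "(\<Sum>k<n. f (\<tau> (Suc k)) - f (\<tau> k)) = f b - f a"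
  using sum_lessThan_telescope[of "\<lambda>k. f (\<tau> k)" n] assms by (simp add: is_partition_def)

text \<open>Partitions of small mesh exist, so the condition defining the Riemann--Stieltjes integral is never
  vacuous; this is what makes the integral unique.\<close>

lemma ex_partition_mesh_less:
  assumes "a < b" "\<delta> > 0"
  shows "\<exists>n \<tau>. is_partition a b n \<tau> \<and> mesh_less \<delta> n \<tau>"
proof -
  obtain n :: nat where n: "(b - a) / \<delta> < real n"
    using reals_Archimedean2 by blast
  moreover have "0 < (b - a) / \<delta>"
    using assms by simp
  ultimately have n0: "real n > 0"
    by linarith
  define \<tau> where "\<tau> = (\<lambda>k. a + (b - a) * real k / real n)"
  have step: "\<tau> (Suc k) - \<tau> k = (b - a) / real n" for k
    by (simp add: \<tau>_def algebra_simps add_divide_distrib diff_divide_distrib)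
  have pos: "0 < (b - a) / real n"
    using assms n0 by simp
  have "\<tau> k < \<tau> (Suc k)" for k
    using step[of k] pos by linarith
  then have "is_partition a b n \<tau>"
    using n0 by (simp add: is_partition_def \<tau>_def)
  moreover have "mesh_less \<delta> n \<tau>"
    using n n0 assms by (auto simp: mesh_less_def step field_simps)
  ultimately show ?thesis by blast
qed

lemma has_rs_integral_unique:
  assumes "a < b" "has_rs_integral a b f g I" "has_rs_integral a b f g J"
  shows "I = J"
proof (rule ccontr)
  assume "I \<noteq> J"
  then have \<epsilon>: "\<bar>I - J\<bar> / 2 > 0" by simp
  obtain \<delta>1 where "\<delta>1 > 0" and 1: "\<forall>n \<tau> c. is_partition a b n \<tau> \<and> mesh_less \<delta>1 n \<tau> \<and>
       (\<forall>k<n. c k \<in> {\<tau> k..\<tau> (Suc k)}) \<longrightarrow>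
       \<bar>(\<Sum>k<n. f (c k) * (g (\<tau> (Suc k)) - g (\<tau> k))) - I\<bar> < \<bar>I - J\<bar> / 2"
    using assms(2)[unfolded has_rs_integral_def, rule_format, OF \<epsilon>] by (elim exE conjE)
  obtain \<delta>2 where "\<delta>2 > 0" and 2: "\<forall>n \<tau> c. is_partition a b n \<tau> \<and> mesh_less \<delta>2 n \<tau> \<and>
       (\<forall>k<n. c k \<in> {\<tau> k..\<tau> (Suc k)}) \<longrightarrow>
       \<bar>(\<Sum>k<n. f (c k) * (g (\<tau> (Suc k)) - g (\<tau> k))) - J\<bar> < \<bar>I - J\<bar> / 2"
    using assms(3)[unfolded has_rs_integral_def, rule_format, OF \<epsilon>] by (elim exE conjE)
  obtain n \<tau> where p: "is_partition a b n \<tau>" "mesh_less (min \<delta>1 \<delta>2) n \<tau>"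
    using ex_partition_mesh_less[OF assms(1), of "min \<delta>1 \<delta>2"] \<open>\<delta>1 > 0\<close> \<open>\<delta>2 > 0\<close> by auto
  have m: "mesh_less \<delta>1 n \<tau>" "mesh_less \<delta>2 n \<tau>"
    using p(2) by (auto simp: mesh_less_def)
  have c: "\<forall>k<n. \<tau> k \<in> {\<tau> k..\<tau> (Suc k)}"
    using p(1) by (auto simp: is_partition_def intro: less_imp_le)
  define S where "S = (\<Sum>k<n. f (\<tau> k) * (g (\<tau> (Suc k)) - g (\<tau> k)))"
  have "\<bar>S - I\<bar> < \<bar>I - J\<bar> / 2" "\<bar>S - J\<bar> < \<bar>I - J\<bar> / 2"
    unfolding S_def using 1[rule_format, of n \<tau> \<tau>] 2[rule_format, of n \<tau> \<tau>] p(1) m c by blast+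
  moreover have "\<bar>I - J\<bar> \<le> \<bar>S - I\<bar> + \<bar>S - J\<bar>"
    by linarith
  ultimately show False
    by (simp add: field_simps)
qed

text \<open>A function \<open>F\<close> whose increments agree with \<open>f dg\<close> up to second order in the length of the interval
  computes the integral: over a partition of mesh \<open>\<delta>\<close> the increments of \<open>F\<close> telescope, and the errors
  add up to at most \<open>K * \<delta> * (b - a)\<close>. No point of the partition has to be a node of a piecewise
  linear \<open>g\<close>, which spares a splitting of the integral at the nodes.\<close>

lemma has_rs_integral_second_order:
  assumes "a < b"
    and K: "\<And>x c y. a \<le> x \<Longrightarrow> x \<le> c \<Longrightarrow> c \<le> y \<Longrightarrow> y \<le> b \<Longrightarrow>
      \<bar>F y - F x - f c * (g y - g x)\<bar> \<le> K * (y - x)\<^sup>2"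
  shows "has_rs_integral a b f g (F b - F a)"
  unfolding has_rs_integral_def
proof (intro allI impI)
  fix \<epsilon> :: real
  assume "\<epsilon> > 0"
  have K0: "K \<ge> 0"
    using order_trans[OF abs_ge_zero K[of a a b]] assms(1) by (simp add: zero_le_mult_iff)
  define \<delta> where "\<delta> = \<epsilon> / ((K + 1) * (b - a))"
  have d: "(K + 1) * \<delta> * (b - a) = \<epsilon>"
    using assms(1) K0 by (simp add: \<delta>_def)
  have "\<delta> > 0"
    using \<open>\<epsilon> > 0\<close> assms(1) K0 by (simp add: \<delta>_def)
  show "\<exists>\<delta>>0. \<forall>n \<tau> c. is_partition a b n \<tau> \<and> mesh_less \<delta> n \<tau> \<and>
      (\<forall>k<n. c k \<in> {\<tau> k..\<tau> (Suc k)}) \<longrightarrow>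
      \<bar>(\<Sum>k<n. f (c k) * (g (\<tau> (Suc k)) - g (\<tau> k))) - (F b - F a)\<bar> < \<epsilon>"
  proof (intro exI[of _ \<delta>] conjI allI impI \<open>\<delta> > 0\<close>)
    fix n \<tau> c
    assume A: "is_partition a b n \<tau> \<and> mesh_less \<delta> n \<tau> \<and> (\<forall>k<n. c k \<in> {\<tau> k..\<tau> (Suc k)})"
    then have p: "is_partition a b n \<tau>" by simp
    have term_le: "\<bar>f (c k) * (g (\<tau> (Suc k)) - g (\<tau> k)) - (F (\<tau> (Suc k)) - F (\<tau> k))\<bar>
        \<le> K * \<delta> * (\<tau> (Suc k) - \<tau> k)" if "k < n" for k
    proof -
      have "\<bar>F (\<tau> (Suc k)) - F (\<tau> k) - f (c k) * (g (\<tau> (Suc k)) - g (\<tau> k))\<bar>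
          \<le> K * (\<tau> (Suc k) - \<tau> k)\<^sup>2"
        using K[of "\<tau> k" "c k" "\<tau> (Suc k)"] partition_in_interval[OF p, of k]
          partition_in_interval[OF p, of "Suc k"] A that by simp
      also have "(\<tau> (Suc k) - \<tau> k)\<^sup>2 \<le> \<delta> * (\<tau> (Suc k) - \<tau> k)"
        using A that unfolding power2_eq_square
        by (intro mult_right_mono) (auto simp: mesh_less_def is_partition_def intro: less_imp_le)
      finally show ?thesis
        using K0 by (simp add: abs_minus_commute mult_left_mono mult.assoc)
    qed
    have "\<bar>(\<Sum>k<n. f (c k) * (g (\<tau> (Suc k)) - g (\<tau> k))) - (F b - F a)\<bar>
        = \<bar>\<Sum>k<n. f (c k) * (g (\<tau> (Suc k)) - g (\<tau> k)) - (F (\<tau> (Suc k)) - F (\<tau> k))\<bar>"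
      using partition_sum_increments[OF p, of F] by (simp add: sum_subtractf)
    also have "\<dots> \<le> (\<Sum>k<n. \<bar>f (c k) * (g (\<tau> (Suc k)) - g (\<tau> k)) - (F (\<tau> (Suc k)) - F (\<tau> k))\<bar>)"
      by (rule sum_abs)
    also have "\<dots> \<le> (\<Sum>k<n. K * \<delta> * (\<tau> (Suc k) - \<tau> k))"
      by (intro sum_mono) (use term_le in auto)
    also have "\<dots> = K * \<delta> * (b - a)"
      using partition_sum_increments[OF p, of id] by (simp flip: sum_distrib_left)
    also have "\<dots> < (K + 1) * \<delta> * (b - a)"
      using \<open>\<delta> > 0\<close> assms(1) by simp
    finally show "\<bar>(\<Sum>k<n. f (c k) * (g (\<tau> (Suc k)) - g (\<tau> k))) - (F b - F a)\<bar> < \<epsilon>"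
      by (simp only: d)
  qed
qed

section \<open>The canonical lift as a weighted double sum\<close>

text \<open>The ramps rise from \<open>0\<close> to \<open>1\<close> on \<open>[k/N, (k+1)/N]\<close> and are constant elsewhere. On \<open>[0,1]\<close> the
  piecewise linear partial sum is a linear combination of them, so that its lift is determined by the
  integrals of one ramp against another.\<close>

definition ramp :: "nat \<Rightarrow> nat \<Rightarrow> real \<Rightarrow> real"
  where "ramp N k s = max 0 (min 1 (real N * s - real k))"

text \<open>The indefinite integral of \<open>ramp N k\<close> against \<open>ramp N l\<close>: while \<open>ramp N l\<close> grows, the integrand is
  already \<open>1\<close> if \<open>k < l\<close>, equals the integrator if \<open>k = l\<close>, and is still \<open>0\<close> if \<open>k > l\<close>.\<close>

definition ramp_primitive :: "nat \<Rightarrow> nat \<Rightarrow> nat \<Rightarrow> real \<Rightarrow> real"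
  where "ramp_primitive N k l s =
    (if k < l then ramp N l s else if k = l then (ramp N k s)\<^sup>2 / 2 else 0)"

definition lift_weight :: "nat \<Rightarrow> nat \<Rightarrow> real"
  where "lift_weight k l = (if k < l then 1 else if k = l then 1/2 else 0)"

text \<open>Each ramp is Lipschitz with constant \<open>N\<close>. In all three cases the error is a product of two factors,
  an increment of an integrator and the deviation of the integrand from the value that it has while the
  integrator grows; either one of them vanishes or both are at most \<open>N * (y - x)\<close>.\<close>

lemma ramp_primitive_second_order:
  assumes "x \<le> c" "c \<le> y"
  shows "\<bar>ramp_primitive N k l y - ramp_primitive N k l x - ramp N k c * (ramp N l y - ramp N l x)\<bar>
    \<le> (real N)\<^sup>2 * (y - x)\<^sup>2"
proof -
  define X C Y where "X = real N * x" and "C = real N * c" and "Y = real N * y"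
  define D where "D = Y - X"
  have XCY: "X \<le> C" "C \<le> Y"
    using assms by (auto simp: X_def C_def Y_def intro: mult_left_mono)
  define h where "h = (\<lambda>j::nat. \<lambda>z::real. max 0 (min 1 (z - real j)))"
  have ramp: "ramp N j x = h j X" "ramp N j c = h j C" "ramp N j y = h j Y" for j
    by (simp_all add: ramp_def h_def X_def C_def Y_def)
  have incr: "\<bar>h j Y - h j X\<bar> \<le> D" for j
    using XCY by (auto simp: h_def D_def)
  have mono: "h j u \<le> h j v" if "u \<le> v" for j u v
    using that by (auto simp: h_def)
  have prod: "\<bar>u * v\<bar> \<le> D\<^sup>2" if "\<bar>u\<bar> \<le> D" "\<bar>v\<bar> \<le> D" for u v
    unfolding abs_mult power2_eq_square using that by (intro mult_mono) auto
  have D2: "(real N)\<^sup>2 * (y - x)\<^sup>2 = D\<^sup>2"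
    by (simp add: D_def X_def Y_def power2_eq_square algebra_simps)
  consider "k < l" | "k = l" | "l < k" by linarith
  then show ?thesis
  proof cases
    case 1
    then have kl: "real k + 1 \<le> real l" by linarith
    \<comment> \<open>If \<open>C < k + 1\<close> and \<open>l < Y\<close>, then \<open>[C, Y]\<close> contains \<open>k + 1\<close>, so \<open>C\<close> misses \<open>k + 1\<close> by at most \<open>D\<close>.\<close>
    have "\<bar>(1 - h k C) * (h l Y - h l X)\<bar> \<le> D\<^sup>2"
    proof (cases "C \<ge> real k + 1 \<or> Y \<le> real l")
      case True
      then have "h k C = 1 \<or> h l Y = h l X"
        using XCY by (auto simp: h_def)
      then show ?thesis by auto
    next
      case False
      then have "\<bar>1 - h k C\<bar> \<le> D"
        using XCY kl by (auto simp: h_def D_def)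
      then show ?thesis
        by (rule prod) (rule incr)
    qed
    then show ?thesis
      using 1 by (simp add: ramp_primitive_def ramp D2 algebra_simps)
  next
    case 2
    \<comment> \<open>The increment of \<open>h\<^sup>2 / 2\<close> is the midpoint value times the increment of \<open>h\<close>.\<close>
    have "\<bar>((h k Y + h k X) / 2 - h k C) * (h k Y - h k X)\<bar> \<le> D\<^sup>2"
    proof (rule prod)
      show "\<bar>(h k Y + h k X) / 2 - h k C\<bar> \<le> D"
        using mono[OF XCY(1), of k] mono[OF XCY(2), of k] incr[of k]
        unfolding abs_le_iff by (simp add: field_simps)
    qed (rule incr)
    also have "((h k Y + h k X) / 2 - h k C) * (h k Y - h k X) =
        (h k Y)\<^sup>2 / 2 - (h k X)\<^sup>2 / 2 - h k C * (h k Y - h k X)"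
      by (simp add: field_simps power2_eq_square)
    finally show ?thesis
      using 2 by (simp add: ramp_primitive_def ramp D2)
  next
    case 3
    then have kl: "real l + 1 \<le> real k" by linarith
    \<comment> \<open>Mirror image of the first case: \<open>[X, C]\<close> contains \<open>k\<close>.\<close>
    have "\<bar>h k C * (h l Y - h l X)\<bar> \<le> D\<^sup>2"
    proof (cases "C \<le> real k \<or> X \<ge> real l + 1")
      case True
      then have "h k C = 0 \<or> h l Y = h l X"
        using XCY by (auto simp: h_def)
      then show ?thesis by auto
    next
      case False
      then have "\<bar>h k C\<bar> \<le> D"
        using XCY kl by (auto simp: h_def D_def)
      then show ?thesis
        by (rule prod) (rule incr)
    qed
    then show ?thesis
      using 3 by (simp add: ramp_primitive_def ramp D2 abs_minus_commute)
  qed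
qed

lemma ramp_primitive_increment:
  assumes "k < N" "l < N"
  shows "ramp_primitive N k l 1 - ramp_primitive N k l 0 = lift_weight k l"
  using assms by (auto simp: ramp_primitive_def ramp_def lift_weight_def)

lemma linear_partial_sum_ramp:
  assumes "s \<in> {0..1}"
  shows "linear_partial_sum \<xi> N s \<omega> = (1 / sqrt N) *\<^sub>R (\<Sum>k<N. ramp N k s *\<^sub>R \<xi> k \<omega>)"
proof -
  define m where "m = nat \<lfloor>real N * s\<rfloor>"
  have Ns: "0 \<le> real N * s" "real N * s \<le> real N"
    using assms by (auto intro: mult_left_le)
  have "real m = of_int \<lfloor>real N * s\<rfloor>"
    using Ns(1) by (simp add: m_def)
  then have m: "real m \<le> real N * s" "real N * s < real m + 1" "frac (real N * s) = real N * s - real m"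
    unfolding frac_def by linarith+
  have mN: "m \<le> N"
    using m(1) Ns(2) by linarith
  have below: "ramp N k s = 1" if "k < m" for k
    using that m(1) by (auto simp: ramp_def)
  have above: "ramp N k s = 0" if "m < k" for k
    using that m(2) by (auto simp: ramp_def)
  have at: "ramp N m s = frac (real N * s)"
    unfolding ramp_def m(3) using m(1,2) by linarith
  have "(\<Sum>k<N. ramp N k s *\<^sub>R \<xi> k \<omega>) = (\<Sum>k<m. \<xi> k \<omega>) + frac (real N * s) *\<^sub>R \<xi> m \<omega>"
  proof (cases "m = N")
    \<comment> \<open>At \<open>s = 1\<close> the next summand \<open>\<xi> N\<close> enters with coefficient \<open>0\<close>.\<close>
    case True
    then have "frac (real N * s) = 0"
      using m(3) m(1) Ns(2) by linarith
    then show ?thesis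
      using True below by simp
  next
    case False
    then have split: "{..<N} = {..<m} \<union> insert m {m<..<N}"
      using mN by auto
    have "(\<Sum>k<N. ramp N k s *\<^sub>R \<xi> k \<omega>) =
        (\<Sum>k<m. ramp N k s *\<^sub>R \<xi> k \<omega>) + (\<Sum>k\<in>insert m {m<..<N}. ramp N k s *\<^sub>R \<xi> k \<omega>)"
      unfolding split by (rule sum.union_disjoint) auto
    then show ?thesis
      by (simp add: below above at)
  qed
  then show ?thesis
    by (simp add: linear_partial_sum_def m_def)
qed

text \<open>The condition of \<open>has_rs_integral_second_order\<close> is bilinear in integrand and integrator, so the
  second order estimate for pairs of ramps passes to the partial sums, with the primitives and the
  constants summed over the pairs.\<close>

lemma canonical_lift_linear_partial_sum:
  "canonical_lift (linear_partial_sum \<xi> N) 1 \<omega> =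
    (1 / N) *\<^sub>R (\<Sum>k<N. \<Sum>l<N. lift_weight k l *\<^sub>R (\<xi> k \<omega> \<otimes>\<^sub>v \<xi> l \<omega>))"
proof -
  have "rs_integral 0 1 (\<lambda>s. linear_partial_sum \<xi> N s \<omega> $ i) (\<lambda>s. linear_partial_sum \<xi> N s \<omega> $ j)
      = (1 / N) * (\<Sum>k<N. \<Sum>l<N. lift_weight k l * (\<xi> k \<omega> $ i * \<xi> l \<omega> $ j))" (is "_ = ?I") for i j
  proof -
    define a where "a = (\<lambda>k. \<xi> k \<omega> $ i)"
    define b where "b = (\<lambda>k. \<xi> k \<omega> $ j)"
    define F where "F = (\<lambda>s. (1 / N) * (\<Sum>k<N. \<Sum>l<N. ramp_primitive N k l s * (a k * b l)))"
    define K where "K = (1 / N) * (\<Sum>k<N. \<Sum>l<N. (real N)\<^sup>2 * \<bar>a k * b l\<bar>)"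
    let ?f = "\<lambda>s. linear_partial_sum \<xi> N s \<omega> $ i"
    let ?g = "\<lambda>s. linear_partial_sum \<xi> N s \<omega> $ j"
    have f: "?f s = (1 / sqrt N) * (\<Sum>k<N. ramp N k s * a k)" if "s \<in> {0..1}" for s
      using linear_partial_sum_ramp[OF that, of \<xi> N \<omega>] by (simp add: a_def)
    have g: "?g s = (1 / sqrt N) * (\<Sum>k<N. ramp N k s * b k)" if "s \<in> {0..1}" for s
      using linear_partial_sum_ramp[OF that, of \<xi> N \<omega>] by (simp add: b_def)
    have "\<bar>F y - F x - ?f c * (?g y - ?g x)\<bar> \<le> K * (y - x)\<^sup>2"
      if "0 \<le> x" "x \<le> c" "c \<le> y" "y \<le> 1" for x c y
    proof -
      have x01: "x \<in> {0..1}" and y01: "y \<in> {0..1}" and c01: "c \<in> {0..1}"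
        using that by auto
      have expand: "F y - F x - ?f c * (?g y - ?g x) = (1 / N) * (\<Sum>k<N. \<Sum>l<N.
          (ramp_primitive N k l y - ramp_primitive N k l x - ramp N k c * (ramp N l y - ramp N l x))
          * (a k * b l))" (is "_ = _ * (\<Sum>k<N. \<Sum>l<N. ?d k l * _)")
      proof -
        have "?g y - ?g x = (1 / sqrt N) * (\<Sum>l<N. (ramp N l y - ramp N l x) * b l)"
          using x01 y01 by (simp only: g left_diff_distrib sum_subtractf right_diff_distrib)
        then have "?f c * (?g y - ?g x) = ((1 / sqrt N) * (\<Sum>k<N. ramp N k c * a k)) *
            ((1 / sqrt N) * (\<Sum>l<N. (ramp N l y - ramp N l x) * b l))"
          using c01 by (simp only: f)
        also have "\<dots> = (1 / N) * ((\<Sum>k<N. ramp N k c * a k) *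
            (\<Sum>l<N. (ramp N l y - ramp N l x) * b l))"
          by simp
        also have "(\<Sum>k<N. ramp N k c * a k) * (\<Sum>l<N. (ramp N l y - ramp N l x) * b l) =
            (\<Sum>k<N. \<Sum>l<N. ramp N k c * (ramp N l y - ramp N l x) * (a k * b l))"
          by (simp only: sum_product mult_ac)
        finally have product: "?f c * (?g y - ?g x) =
            (1 / N) * (\<Sum>k<N. \<Sum>l<N. ramp N k c * (ramp N l y - ramp N l x) * (a k * b l))" .
        show ?thesis
          unfolding product F_def by (simp only: left_diff_distrib sum_subtractf right_diff_distrib)
      qed
      have "\<bar>(1 / N) * (\<Sum>k<N. \<Sum>l<N. ?d k l * (a k * b l))\<bar>
          \<le> (1 / N) * (\<Sum>k<N. \<Sum>l<N. (real N)\<^sup>2 * (y - x)\<^sup>2 * \<bar>a k * b l\<bar>)"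
      proof -
        have "\<bar>\<Sum>k<N. \<Sum>l<N. ?d k l * (a k * b l)\<bar> \<le> (\<Sum>k<N. \<Sum>l<N. \<bar>?d k l * (a k * b l)\<bar>)"
          by (rule order_trans[OF sum_abs]) (intro sum_mono sum_abs)
        also have "\<dots> \<le> (\<Sum>k<N. \<Sum>l<N. (real N)\<^sup>2 * (y - x)\<^sup>2 * \<bar>a k * b l\<bar>)"
          unfolding abs_mult[of "?d _ _"]
          by (intro sum_mono mult_right_mono ramp_primitive_second_order that) auto
        finally show ?thesis
          unfolding abs_mult[of "1 / real N"] by (simp add: mult_left_mono divide_right_mono)
      qed
      also have "\<dots> = K * (y - x)\<^sup>2"
        by (simp only: K_def sum_distrib_left sum_distrib_right mult_ac)
      finally show ?thesis
        unfolding expand .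
    qed
    then have "has_rs_integral 0 1 ?f ?g (F 1 - F 0)"
      by (intro has_rs_integral_second_order[where K = K]) auto
    moreover have "F 1 - F 0 = ?I"
    proof -
      have "F 1 - F 0 = (1 / N) * (\<Sum>k<N. \<Sum>l<N.
          (ramp_primitive N k l 1 - ramp_primitive N k l 0) * (a k * b l))"
        by (simp only: F_def left_diff_distrib sum_subtractf right_diff_distrib)
      then show ?thesis
        by (simp add: ramp_primitive_increment a_def b_def)
    qed
    ultimately have "has_rs_integral 0 1 ?f ?g ?I" by simp
    then show ?thesis
      unfolding rs_integral_def using has_rs_integral_unique[of 0 1] by (intro the_equality) auto
  qed
  then show ?thesis
    by (simp add: canonical_lift_def vec_eq_iff outer_def)
qed

section \<open>Stationary second moments and the expected lift\<close>

lemma outer_nth [simp]: "(x \<otimes>\<^sub>v y) $ i $ j = x $ i * y $ j"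
  by (simp add: outer_def)

lemma transpose_nth [simp]: "transpose A $ i $ j = A $ j $ i"
  by (simp add: transpose_def)

lemma transpose_outer: "transpose (x \<otimes>\<^sub>v y) = y \<otimes>\<^sub>v x"
  by (simp add: vec_eq_iff mult.commute)

lemma bounded_bilinear_outer: "bounded_bilinear (outer :: real ^ 'd \<Rightarrow> _)"
  unfolding bilinear_conv_bounded_bilinear[symmetric]
  by (auto simp: bilinear_def linear_iff vec_eq_iff algebra_simps)

lemma bounded_linear_transpose: "bounded_linear (transpose :: real ^ 'n ^ 'm \<Rightarrow> real ^ 'm ^ 'n)"
  unfolding linear_conv_bounded_linear[symmetric]
  by (simp add: linear_iff vec_eq_iff)

lemma borel_measurable_vec_nth [measurable (raw)]:
  fixes X :: "'a \<Rightarrow> 'b::real_normed_vector ^ 'n"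
  assumes "X \<in> borel_measurable M"
  shows "(\<lambda>\<omega>. X \<omega> $ i) \<in> borel_measurable M"
  by (rule borel_measurable_continuous_on[OF _ assms]) (intro continuous_intros)

lemma borel_measurable_outer [measurable (raw)]:
  fixes X Y :: "'a \<Rightarrow> real ^ 'd"
  assumes "X \<in> borel_measurable M" "Y \<in> borel_measurable M"
  shows "(\<lambda>\<omega>. X \<omega> \<otimes>\<^sub>v Y \<omega>) \<in> borel_measurable M"
  using assms by (intro borel_measurable_continuous_Pair[where H = outer]
      bounded_bilinear.continuous_on[OF bounded_bilinear_outer] continuous_intros)

lemma integrable_outer:
  fixes X Y :: "'a \<Rightarrow> real ^ 'd"
  assumes [measurable]: "X \<in> borel_measurable M" "Y \<in> borel_measurable M"
    and "integrable M (\<lambda>\<omega>. (norm (X \<omega>))\<^sup>2)" "integrable M (\<lambda>\<omega>. (norm (Y \<omega>))\<^sup>2)"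
  shows "integrable M (\<lambda>\<omega>. X \<omega> \<otimes>\<^sub>v Y \<omega>)"
proof -
  obtain K where K: "K \<ge> 0" "\<And>x y :: real ^ 'd. norm (x \<otimes>\<^sub>v y) \<le> norm x * norm y * K"
    using bounded_bilinear.nonneg_bounded[OF bounded_bilinear_outer] by blast
  have "integrable M (\<lambda>\<omega>. ((norm (X \<omega>))\<^sup>2 + (norm (Y \<omega>))\<^sup>2) * K)"
    using assms by (intro integrable_mult_left Bochner_Integration.integrable_add)
  then show ?thesis
  proof (rule Bochner_Integration.integrable_bound)
    show "AE \<omega> in M. norm (X \<omega> \<otimes>\<^sub>v Y \<omega>) \<le> norm (((norm (X \<omega>))\<^sup>2 + (norm (Y \<omega>))\<^sup>2) * K)"
    proof (intro AE_I2)
      fix \<omega>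
      have "norm (X \<omega>) * norm (Y \<omega>) \<le> (norm (X \<omega>))\<^sup>2 + (norm (Y \<omega>))\<^sup>2"
        using sum_squares_bound[of "norm (X \<omega>)" "norm (Y \<omega>)"]
          mult_nonneg_nonneg[OF norm_ge_zero norm_ge_zero, of "X \<omega>" "Y \<omega>"] by linarith
      then have "norm (X \<omega>) * norm (Y \<omega>) * K \<le> ((norm (X \<omega>))\<^sup>2 + (norm (Y \<omega>))\<^sup>2) * K"
        using K(1) by (rule mult_right_mono)
      then show "norm (X \<omega> \<otimes>\<^sub>v Y \<omega>) \<le> norm (((norm (X \<omega>))\<^sup>2 + (norm (Y \<omega>))\<^sup>2) * K)"
        using K(2)[of "X \<omega>" "Y \<omega>"] by (simp only: real_norm_def)
    qed
  qed measurable
qed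

lemma integrable_vec_nth:
  fixes X :: "'a \<Rightarrow> 'b::euclidean_space ^ 'n"
  assumes "integrable M X"
  shows "integrable M (\<lambda>\<omega>. X \<omega> $ i)" and "(\<integral>\<omega>. X \<omega> \<partial>M) $ i = (\<integral>\<omega>. X \<omega> $ i \<partial>M)"
  using assms integral_bounded_linear[OF bounded_linear_vec_nth, of M X]
    integrable_bounded_linear[OF bounded_linear_vec_nth, of M X] by auto

text \<open>Stationarity is equality of laws on sequence space, hence it transfers the expectation of every
  measurable function of the whole sequence, in particular of a product of two entries.\<close>

lemma stationary_process_shift:
  fixes \<xi> :: "nat \<Rightarrow> 'a \<Rightarrow> 'x::topological_space"
    and G :: "(nat \<Rightarrow> 'x) \<Rightarrow> 'b::{banach, second_countable_topology}"
  assumes "stationary_process M \<xi>" and G: "G \<in> borel_measurable (PiM UNIV (\<lambda>_. borel))"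
  shows "integrable M (\<lambda>\<omega>. G (\<lambda>k. \<xi> (k + h) \<omega>)) \<longleftrightarrow> integrable M (\<lambda>\<omega>. G (\<lambda>k. \<xi> k \<omega>))"
    and "(\<integral>\<omega>. G (\<lambda>k. \<xi> (k + h) \<omega>) \<partial>M) = (\<integral>\<omega>. G (\<lambda>k. \<xi> k \<omega>) \<partial>M)"
proof -
  have [measurable]: "\<xi> k \<in> borel_measurable M" for k
    using assms(1) by (simp add: stationary_process_def)
  have m: "(\<lambda>\<omega> k. \<xi> (k + h) \<omega>) \<in> measurable M (PiM UNIV (\<lambda>_. borel))" for h
    by (rule measurable_PiM_single') auto
  have m0: "(\<lambda>\<omega> k. \<xi> k \<omega>) \<in> measurable M (PiM UNIV (\<lambda>_. borel))"
    using m[of 0] by simp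
  have eq: "distr M (PiM UNIV (\<lambda>_. borel)) (\<lambda>\<omega> k. \<xi> (k + h) \<omega>) =
         distr M (PiM UNIV (\<lambda>_. borel)) (\<lambda>\<omega> k. \<xi> k \<omega>)"
    using assms(1) by (simp add: stationary_process_def)
  show "integrable M (\<lambda>\<omega>. G (\<lambda>k. \<xi> (k + h) \<omega>)) \<longleftrightarrow> integrable M (\<lambda>\<omega>. G (\<lambda>k. \<xi> k \<omega>))"
    using integrable_distr_eq[OF m[of h] G] integrable_distr_eq[OF m0 G] eq by simp
  show "(\<integral>\<omega>. G (\<lambda>k. \<xi> (k + h) \<omega>) \<partial>M) = (\<integral>\<omega>. G (\<lambda>k. \<xi> k \<omega>) \<partial>M)"
    using integral_distr[OF m[of h] G] integral_distr[OF m0 G] eq by simp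
qed

lemma stationary_second_moments:
  fixes \<xi> :: "nat \<Rightarrow> 'a \<Rightarrow> real ^ 'd"
  assumes \<xi>: "stationary_process M \<xi>" and sq: "integrable M (\<lambda>\<omega>. (norm (\<xi> 0 \<omega>))\<^sup>2)"
  shows integrable_stationary_outer: "integrable M (\<lambda>\<omega>. \<xi> k \<omega> \<otimes>\<^sub>v \<xi> l \<omega>)"
    and integral_stationary_outer:
      "k \<le> l \<Longrightarrow> (\<integral>\<omega>. \<xi> k \<omega> \<otimes>\<^sub>v \<xi> l \<omega> \<partial>M) = correlation M \<xi> (l - k)"
proof -
  have [measurable]: "\<xi> k \<in> borel_measurable M" for k
    using \<xi> by (simp add: stationary_process_def)
  have "integrable M (\<lambda>\<omega>. (norm (\<xi> k \<omega>))\<^sup>2)" for k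
    using stationary_process_shift(1)[OF \<xi>, of "\<lambda>x. (norm (x 0))\<^sup>2" k] sq by simp
  then show "integrable M (\<lambda>\<omega>. \<xi> k \<omega> \<otimes>\<^sub>v \<xi> l \<omega>)"
    by (intro integrable_outer) auto
  show "(\<integral>\<omega>. \<xi> k \<omega> \<otimes>\<^sub>v \<xi> l \<omega> \<partial>M) = correlation M \<xi> (l - k)" if "k \<le> l"
    using stationary_process_shift(2)[OF \<xi>, of "\<lambda>x. x 0 \<otimes>\<^sub>v x (l - k)" k] that
    by (simp add: correlation_def)
qed

lemma transpose_correlation_0:
  assumes "stationary_process M \<xi>" and "integrable M (\<lambda>\<omega>. (norm (\<xi> 0 \<omega>))\<^sup>2)"
  shows "transpose (correlation M \<xi> 0) = correlation M \<xi> 0"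
  using integral_bounded_linear[OF bounded_linear_transpose integrable_stationary_outer[OF assms, of 0 0]]
  by (simp add: correlation_def transpose_outer)

text \<open>Summing column by column: for fixed \<open>l\<close> the indices \<open>k < l\<close> contribute the correlations of lags
  \<open>1, \<dots>, l\<close>, and the diagonal half the variance. The expectation is thus, up to the diagonal term, a
  Cesaro mean of the partial sums of the correlation series.\<close>

lemma integral_canonical_lift:
  fixes \<xi> :: "nat \<Rightarrow> 'a \<Rightarrow> real ^ 'd"
  assumes \<xi>: "stationary_process M \<xi>" and sq: "integrable M (\<lambda>\<omega>. (norm (\<xi> 0 \<omega>))\<^sup>2)"
    and N: "N \<ge> 1"
  shows "(\<integral>\<omega>. canonical_lift (linear_partial_sum \<xi> N) 1 \<omega> \<partial>M) =
    (1/2) *\<^sub>R correlation M \<xi> 0 + (1 / real N) *\<^sub>R (\<Sum>l<N. \<Sum>n<l. correlation M \<xi> (Suc n))"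
proof -
  let ?E = "\<lambda>k l. \<integral>\<omega>. \<xi> k \<omega> \<otimes>\<^sub>v \<xi> l \<omega> \<partial>M"
  have column: "(\<Sum>k<N. lift_weight k l *\<^sub>R ?E k l) =
      (\<Sum>n<l. correlation M \<xi> (Suc n)) + (1/2) *\<^sub>R correlation M \<xi> 0" if "l < N" for l
  proof -
    have "(\<Sum>k<N. lift_weight k l *\<^sub>R ?E k l) = (\<Sum>k<Suc l. lift_weight k l *\<^sub>R ?E k l)"
      using that by (intro sum.mono_neutral_right) (auto simp: lift_weight_def)
    \<comment> \<open>The lag \<open>l - k\<close> is written as \<open>Suc (l - Suc k)\<close> so that the sum can be reversed.\<close>
    also have "\<dots> = (\<Sum>k<l. correlation M \<xi> (Suc (l - Suc k))) + (1/2) *\<^sub>R correlation M \<xi> 0"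
      by (simp add: lift_weight_def integral_stationary_outer[OF \<xi> sq] Suc_diff_Suc)
    also have "(\<Sum>k<l. correlation M \<xi> (Suc (l - Suc k))) = (\<Sum>n<l. correlation M \<xi> (Suc n))"
      by (rule sum.nat_diff_reindex)
    finally show ?thesis .
  qed
  have "(\<integral>\<omega>. canonical_lift (linear_partial_sum \<xi> N) 1 \<omega> \<partial>M) =
      (1 / N) *\<^sub>R (\<Sum>k<N. \<Sum>l<N. lift_weight k l *\<^sub>R ?E k l)"
    by (simp add: canonical_lift_linear_partial_sum Bochner_Integration.integral_sum
        integrable_stationary_outer[OF \<xi> sq])
  also have "(\<Sum>k<N. \<Sum>l<N. lift_weight k l *\<^sub>R ?E k l) = (\<Sum>l<N. \<Sum>k<N. lift_weight k l *\<^sub>R ?E k l)"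
    by (rule sum.swap)
  also have "\<dots> = (\<Sum>l<N. (\<Sum>n<l. correlation M \<xi> (Suc n)) + (1/2) *\<^sub>R correlation M \<xi> 0)"
    by (intro sum.cong refl column) simp
  finally show ?thesis
    using N by (simp add: sum.distrib scaleR_add_right sum_constant_scaleR del: sum_constant)
qed

lemma cesaro_mean_tendsto:
  fixes X :: "nat \<Rightarrow> 'a::real_normed_vector"
  assumes "X \<longlonglongrightarrow> L"
  shows "(\<lambda>N. (1 / real N) *\<^sub>R (\<Sum>l<N. X l)) \<longlonglongrightarrow> L"
proof (rule LIMSEQ_I)
  fix e :: real
  assume "e > 0"
  then obtain m where m: "\<And>l. l \<ge> m \<Longrightarrow> norm (X l - L) < e / 2"
    using LIMSEQ_D[OF assms, of "e / 2"] by auto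
  define S where "S = (\<Sum>l<m. norm (X l - L))"
  have "(\<lambda>N. S * (1 / real N)) \<longlonglongrightarrow> S * 0"
    by (intro tendsto_mult tendsto_const lim_1_over_n)
  then have "\<forall>\<^sub>F N in sequentially. S * (1 / real N) < e / 2"
    using \<open>e > 0\<close> by (intro order_tendstoD(2)) auto
  then obtain n0 where n0: "\<And>N. N \<ge> n0 \<Longrightarrow> S * (1 / real N) < e / 2"
    by (auto simp: eventually_sequentially)
  show "\<exists>no. \<forall>N\<ge>no. norm ((1 / real N) *\<^sub>R (\<Sum>l<N. X l) - L) < e"
  proof (intro exI[of _ "max (Suc m) n0"] allI impI)
    fix N assume N: "N \<ge> max (Suc m) n0"
    then have N0: "real N > 0" by simp
    have "(1 / real N) *\<^sub>R (\<Sum>l<N. X l) - L = (1 / real N) *\<^sub>R (\<Sum>l<N. X l - L)"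
      using N0 by (simp add: sum_subtractf scaleR_diff_right sum_constant_scaleR)
    then have "norm ((1 / real N) *\<^sub>R (\<Sum>l<N. X l) - L) \<le> (1 / real N) * (\<Sum>l<N. norm (X l - L))"
      using N0 by (simp add: norm_sum divide_right_mono)
    also have "(\<Sum>l<N. norm (X l - L)) = S + (\<Sum>l=m..<N. norm (X l - L))"
      unfolding S_def using N sum.atLeastLessThan_concat[of 0 m N "\<lambda>l. norm (X l - L)"]
      by (simp add: atLeast0LessThan)
    also have "(\<Sum>l=m..<N. norm (X l - L)) \<le> (\<Sum>l=m..<N. e / 2)"
      by (intro sum_mono) (use m less_imp_le in auto)
    also have "(\<Sum>l=m..<N. e / 2) \<le> real N * (e / 2)"
      using \<open>e > 0\<close> by (auto intro: mult_right_mono)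
    finally have "norm ((1 / real N) *\<^sub>R (\<Sum>l<N. X l) - L) \<le> (1 / real N) * (S + real N * (e / 2))"
      using N0 by (simp add: divide_right_mono)
    also have "\<dots> = S * (1 / real N) + e / 2"
      using N0 by (simp add: field_simps)
    also have "\<dots> < e"
    proof -
      have "S * (1 / real N) < e / 2"
        using N by (intro n0) simp
      then show ?thesis by linarith
    qed
    finally show "norm ((1 / real N) *\<^sub>R (\<Sum>l<N. X l) - L) < e" .
  qed
qed

lemma integral_canonical_lift_tendsto:
  fixes \<xi> :: "nat \<Rightarrow> 'a \<Rightarrow> real ^ 'd"
  assumes \<xi>: "stationary_process M \<xi>" and sq: "integrable M (\<lambda>\<omega>. (norm (\<xi> 0 \<omega>))\<^sup>2)"
    and "summable (\<lambda>n. correlation M \<xi> (Suc n))"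
  shows "(\<lambda>N. \<integral>\<omega>. canonical_lift (linear_partial_sum \<xi> N) 1 \<omega> \<partial>M) \<longlonglongrightarrow>
    (1/2) *\<^sub>R correlation M \<xi> 0 + (\<Sum>n. correlation M \<xi> (Suc n))"
proof (rule Lim_transform_eventually)
  show "(\<lambda>N. (1/2) *\<^sub>R correlation M \<xi> 0 +
      (1 / real N) *\<^sub>R (\<Sum>l<N. \<Sum>n<l. correlation M \<xi> (Suc n))) \<longlonglongrightarrow>
    (1/2) *\<^sub>R correlation M \<xi> 0 + (\<Sum>n. correlation M \<xi> (Suc n))"
    by (intro tendsto_add tendsto_const cesaro_mean_tendsto summable_LIMSEQ assms)
  show "\<forall>\<^sub>F N in sequentially. (1/2) *\<^sub>R correlation M \<xi> 0 +
      (1 / real N) *\<^sub>R (\<Sum>l<N. \<Sum>n<l. correlation M \<xi> (Suc n)) =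
      (\<integral>\<omega>. canonical_lift (linear_partial_sum \<xi> N) 1 \<omega> \<partial>M)"
    using integral_canonical_lift[OF \<xi> sq] by (intro eventually_sequentiallyI[of 1]) simp
qed

text \<open>Integration by parts for the lift: the weights of \<open>(k, l)\<close> and \<open>(l, k)\<close> add up to \<open>1\<close>. It reduces
  the covariance of the partial sums to the expectation of the lift.\<close>

lemma outer_linear_partial_sum:
  fixes \<xi> :: "nat \<Rightarrow> 'a \<Rightarrow> real ^ 'd"
  shows "linear_partial_sum \<xi> N 1 \<omega> \<otimes>\<^sub>v linear_partial_sum \<xi> N 1 \<omega> =
    canonical_lift (linear_partial_sum \<xi> N) 1 \<omega> + transpose (canonical_lift (linear_partial_sum \<xi> N) 1 \<omega>)"
proof -
  have S: "linear_partial_sum \<xi> N 1 \<omega> = (1 / sqrt N) *\<^sub>R (\<Sum>k<N. \<xi> k \<omega>)"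
    by (simp add: linear_partial_sum_ramp ramp_def)
  have weights: "lift_weight k l + lift_weight l k = 1" for k l
    by (simp add: lift_weight_def)
  have "linear_partial_sum \<xi> N 1 \<omega> $ i * linear_partial_sum \<xi> N 1 \<omega> $ j =
      canonical_lift (linear_partial_sum \<xi> N) 1 \<omega> $ i $ j +
      canonical_lift (linear_partial_sum \<xi> N) 1 \<omega> $ j $ i" for i j
  proof -
    let ?p = "\<lambda>k l. \<xi> k \<omega> $ i * \<xi> l \<omega> $ j"
    have "canonical_lift (linear_partial_sum \<xi> N) 1 \<omega> $ i $ j +
        canonical_lift (linear_partial_sum \<xi> N) 1 \<omega> $ j $ i =
        (1 / N) * ((\<Sum>k<N. \<Sum>l<N. lift_weight k l * ?p k l) + (\<Sum>l<N. \<Sum>k<N. lift_weight l k * ?p k l))"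
      by (simp add: canonical_lift_linear_partial_sum add_divide_distrib mult_ac)
    also have "(\<Sum>l<N. \<Sum>k<N. lift_weight l k * ?p k l) = (\<Sum>k<N. \<Sum>l<N. lift_weight l k * ?p k l)"
      by (rule sum.swap)
    also have "(\<Sum>k<N. \<Sum>l<N. lift_weight k l * ?p k l) + \<dots> = (\<Sum>k<N. \<Sum>l<N. ?p k l)"
      by (simp only: sum.distrib[symmetric] distrib_right[symmetric] weights mult_1)
    also have "\<dots> = (\<Sum>k<N. \<xi> k \<omega> $ i) * (\<Sum>l<N. \<xi> l \<omega> $ j)"
      by (simp add: sum_product)
    finally show ?thesis
      by (simp add: S)
  qed
  then show ?thesis
    by (simp add: vec_eq_iff)
qed

section \<open>Gaussian moments\<close>

lemma (in prob_space) centred_normal_moments: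
  assumes "centred_normal M v X"
  shows "integrable M (\<lambda>\<omega>. X \<omega> ^ n)"
    and "expectation X = 0"
    and "expectation (\<lambda>\<omega>. (X \<omega>)\<^sup>2) = v"
    and "expectation (\<lambda>\<omega>. X \<omega> ^ 4) = 3 * v\<^sup>2"
proof -
  have "integrable M (\<lambda>\<omega>. X \<omega> ^ n) \<and> expectation X = 0 \<and>
      expectation (\<lambda>\<omega>. (X \<omega>)\<^sup>2) = v \<and> expectation (\<lambda>\<omega>. X \<omega> ^ 4) = 3 * v\<^sup>2"
    using assms unfolding centred_normal_def
  proof (elim disjE conjE)
    assume "v > 0" and D: "distributed M lborel X (normal_density 0 (sqrt v))"
    then have s: "sqrt v > 0" by simp
    have "integrable M (\<lambda>\<omega>. X \<omega> ^ n)"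
      using distributed_integrable[OF D, of "\<lambda>x. x ^ n"] integrable_normal_moment[OF s, of 0 n]
      by simp
    moreover have "expectation X = 0"
      using distributed_integral[OF D, of "\<lambda>x. x"] integral_normal_moment_odd[OF s, of 0 0] by simp
    moreover have "expectation (\<lambda>\<omega>. (X \<omega>)\<^sup>2) = v"
      using distributed_integral[OF D, of "\<lambda>x. x\<^sup>2"] integral_normal_moment_even[OF s, of 0 1] \<open>v > 0\<close>
      by simp
    moreover have "expectation (\<lambda>\<omega>. X \<omega> ^ 4) = 3 * v\<^sup>2"
      using distributed_integral[OF D, of "\<lambda>x. x ^ 4"] integral_normal_moment_even[OF s, of 0 2] \<open>v > 0\<close>
      by (simp add: fact_numeral power_divide power2_eq_square)
    ultimately show ?thesis by simp
  next
    assume "v = 0" and [measurable]: "X \<in> borel_measurable M" and z: "AE \<omega> in M. X \<omega> = 0"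
    have ae: "AE \<omega> in M. X \<omega> ^ m = 0 ^ m" for m
      using z by eventually_elim simp
    have "integrable M (\<lambda>\<omega>. X \<omega> ^ n)"
      by (subst integrable_cong_AE[OF _ _ ae]) auto
    moreover have "expectation (\<lambda>\<omega>. X \<omega> ^ m) = 0 ^ m" for m
      by (subst integral_cong_AE[OF _ _ ae]) (auto simp: prob_space)
    from this[of 1] this[of 2] this[of 4]
    have "expectation X = 0" "expectation (\<lambda>\<omega>. (X \<omega>)\<^sup>2) = 0" "expectation (\<lambda>\<omega>. X \<omega> ^ 4) = 0"
      by simp_all
    ultimately show ?thesis
      using \<open>v = 0\<close> by simp
  qed
  then show "integrable M (\<lambda>\<omega>. X \<omega> ^ n)" "expectation X = 0"
    "expectation (\<lambda>\<omega>. (X \<omega>)\<^sup>2) = v" "expectation (\<lambda>\<omega>. X \<omega> ^ 4) = 3 * v\<^sup>2"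
    by auto
qed

lemma matrix_entry_inner_axis:
  fixes A :: "real ^ 'd ^ 'd"
  shows "axis i 1 \<bullet> (A *v axis j 1) = A $ i $ j"
  by (simp add: inner_axis' matrix_vector_mult_basis column_def)

text \<open>Being Gaussian is a condition on one-dimensional projections, so mixed second moments come by
  polarisation: \<open>4 * x\<^sub>i * x\<^sub>j\<close> is the difference of the squares of \<open>x\<^sub>i + x\<^sub>j\<close> and \<open>x\<^sub>i - x\<^sub>j\<close>. Symmetry of \<open>C\<close>
  enters here.\<close>

lemma (in prob_space) centred_gaussian_moments:
  fixes X :: "'a \<Rightarrow> real ^ 'd"
  assumes X: "centred_gaussian M C X"
  shows "integrable M (\<lambda>\<omega>. (X \<omega> $ i) ^ n)"
    and "expectation (\<lambda>\<omega>. X \<omega> $ i) = 0"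
    and "expectation (\<lambda>\<omega>. (X \<omega> $ i) ^ 4) = 3 * (C $ i $ i)\<^sup>2"
    and "integrable M (\<lambda>\<omega>. X \<omega> $ i * X \<omega> $ j)"
    and "expectation (\<lambda>\<omega>. X \<omega> $ i * X \<omega> $ j) = C $ i $ j"
proof -
  have cn: "centred_normal M (u \<bullet> (C *v u)) (\<lambda>\<omega>. u \<bullet> X \<omega>)" for u
    using X by (simp add: centred_gaussian_def)
  have coord: "centred_normal M (C $ i $ i) (\<lambda>\<omega>. X \<omega> $ i)" for i
    using cn[of "axis i 1"] by (simp add: matrix_entry_inner_axis) (simp add: inner_axis')
  show "integrable M (\<lambda>\<omega>. (X \<omega> $ i) ^ n)" "expectation (\<lambda>\<omega>. X \<omega> $ i) = 0"
    "expectation (\<lambda>\<omega>. (X \<omega> $ i) ^ 4) = 3 * (C $ i $ i)\<^sup>2"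
    using centred_normal_moments[OF coord] by auto
  let ?u = "axis i 1 + axis j 1 :: real ^ 'd" and ?v = "axis i 1 - axis j 1 :: real ^ 'd"
  have sym: "C $ j $ i = C $ i $ j"
    using X by (metis centred_gaussian_def transpose_nth)
  have u: "?u \<bullet> x = x $ i + x $ j" "?v \<bullet> x = x $ i - x $ j" for x
    by (simp_all add: inner_add_left inner_diff_left inner_axis')
  have polar: "X \<omega> $ i * X \<omega> $ j = ((?u \<bullet> X \<omega>)\<^sup>2 - (?v \<bullet> X \<omega>)\<^sup>2) / 4" for \<omega>
    unfolding u by (simp add: power2_eq_square algebra_simps)
  have ints: "integrable M (\<lambda>\<omega>. (?u \<bullet> X \<omega>)\<^sup>2)" "integrable M (\<lambda>\<omega>. (?v \<bullet> X \<omega>)\<^sup>2)"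
    using centred_normal_moments(1)[OF cn] by auto
  show "integrable M (\<lambda>\<omega>. X \<omega> $ i * X \<omega> $ j)"
    unfolding polar using ints by simp
  have "expectation (\<lambda>\<omega>. X \<omega> $ i * X \<omega> $ j) = (?u \<bullet> (C *v ?u) - ?v \<bullet> (C *v ?v)) / 4"
    unfolding polar using ints centred_normal_moments(3)[OF cn[of ?u]] centred_normal_moments(3)[OF cn[of ?v]]
    by simp
  also have "\<dots> = C $ i $ j"
    by (simp add: matrix_vector_right_distrib matrix_vector_mult_diff_distrib inner_add_left
        inner_add_right inner_diff_left inner_diff_right matrix_entry_inner_axis sym)
  finally show "expectation (\<lambda>\<omega>. X \<omega> $ i * X \<omega> $ j) = C $ i $ j" .
qed

section \<open>Increments of Brownian motion: independence and moments\<close>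

lemma space_nat_filtration [simp]: "space (nat_filtration P B t) = space P"
  by (simp add: nat_filtration_def space_measure_of_conv)

lemma nat_filtration_measurable:
  fixes B :: "real \<Rightarrow> 'b \<Rightarrow> 'x::topological_space"
  assumes "0 \<le> s" "s \<le> t"
  shows "B s \<in> borel_measurable (nat_filtration P B t)"
proof (rule measurableI)
  fix A :: "'x set"
  assume "A \<in> sets borel"
  then show "B s -` A \<inter> space (nat_filtration P B t) \<in> sets (nat_filtration P B t)"
    unfolding nat_filtration_def using assms
    by (subst sets_measure_of) (auto simp: space_measure_of_conv intro!: sigma_sets.Basic)
qed simp

lemma nat_filtration_mono:
  assumes "s \<le> t"
  shows "borel_measurable (nat_filtration P B s) \<subseteq> borel_measurable (nat_filtration P B t)"
  unfolding nat_filtration_def using assms by (intro measurable_mono1) (auto, force)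

lemma sets_nat_filtration_subset:
  assumes "\<And>s. s \<ge> 0 \<Longrightarrow> B s \<in> borel_measurable P"
  shows "sets (nat_filtration P B t) \<subseteq> sets P"
  unfolding nat_filtration_def
  by (subst sets_measure_of) (auto intro!: sets.sigma_sets_subset measurable_sets[OF assms])

lemma borel_measurable_nat_filtration:
  assumes "\<And>s. s \<ge> 0 \<Longrightarrow> B s \<in> borel_measurable P"
  shows "borel_measurable (nat_filtration P B t) \<subseteq> borel_measurable P"
  using sets_nat_filtration_subset[OF assms] by (intro measurable_mono) auto

text \<open>Independence of the past and the increment as \<open>\<sigma>\<close>-algebras, in the form in which it is used below:
  expectations of products factor.\<close>

lemma brownian_motion_independent_increment:
  fixes B :: "real \<Rightarrow> 'b \<Rightarrow> real ^ 'd"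
  assumes B: "brownian_motion P C B" and st: "0 \<le> s" "s \<le> t"
    and Z: "Z \<in> borel_measurable (nat_filtration P B s)" "integrable P Z"
    and h: "h \<in> borel_measurable borel" "integrable P (\<lambda>\<omega>. h (B t \<omega> - B s \<omega>))"
  shows "integrable P (\<lambda>\<omega>. Z \<omega> * h (B t \<omega> - B s \<omega>) :: real)"
    and "(\<integral>\<omega>. Z \<omega> * h (B t \<omega> - B s \<omega>) \<partial>P) = (\<integral>\<omega>. Z \<omega> \<partial>P) * (\<integral>\<omega>. h (B t \<omega> - B s \<omega>) \<partial>P)"
proof -
  interpret prob_space P
    using B by (simp add: brownian_motion_def)
  have m: "B t \<in> borel_measurable P" if "t \<ge> 0" for t
    using B that by (simp add: brownian_motion_def)
  let ?D = "\<lambda>\<omega>. B t \<omega> - B s \<omega>"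
  let ?\<D> = "{?D -` A \<inter> space P | A. A \<in> sets borel}"
  have D: "?D \<in> borel_measurable P"
    using m[of s] m[of t] st by simp
  have indep: "indep_set (sets (nat_filtration P B s)) ?\<D>"
    using B st by (simp add: brownian_motion_def)
  have preimages: "sigma_sets (space P) {Y -` A \<inter> space P | A. A \<in> sets borel} \<subseteq> sets N"
    if "Y \<in> borel_measurable N" "space N = space P" for N and Y :: "'b \<Rightarrow> real"
    by (rule sets.sigma_sets_subset[of _ N, unfolded that(2)])
      (use measurable_sets[OF that(1)] that(2) in auto)
  have "indep_var borel Z borel (\<lambda>\<omega>. h (?D \<omega>))"
    unfolding indep_var_eq
  proof (intro conjI)
    show "Z \<in> borel_measurable P" using Z(2) by simp
    show "(\<lambda>\<omega>. h (?D \<omega>)) \<in> borel_measurable P" using h(2) by simp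
    \<comment> \<open>The preimages under the increment already form a \<open>\<sigma>\<close>-algebra, the one that the increment generates.\<close>
    let ?V = "vimage_algebra (space P) ?D borel"
    have V: "?\<D> = sets ?V"
      by (auto simp: sets_vimage_algebra2)
    have "?D \<in> borel_measurable ?V"
      by (rule measurable_vimage_algebra1) simp
    then have hV: "(\<lambda>\<omega>. h (?D \<omega>)) \<in> borel_measurable ?V"
      using h(1) by (rule measurable_compose)
    show "indep_set (sigma_sets (space P) {Z -` A \<inter> space P | A. A \<in> sets borel})
        (sigma_sets (space P) {(\<lambda>\<omega>. h (?D \<omega>)) -` A \<inter> space P | A. A \<in> sets borel})"
      unfolding indep_set_def
    proof (rule indep_sets_mono_sets[OF indep[unfolded indep_set_def]])
      fix i :: bool
      show "case_bool (sigma_sets (space P) {Z -` A \<inter> space P | A. A \<in> sets borel})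
          (sigma_sets (space P) {(\<lambda>\<omega>. h (?D \<omega>)) -` A \<inter> space P | A. A \<in> sets borel}) i
          \<subseteq> case_bool (sets (nat_filtration P B s)) ?\<D> i"
        using preimages[OF Z(1)] preimages[OF hV] V by (cases i) simp_all
    qed
  qed
  then show "integrable P (\<lambda>\<omega>. Z \<omega> * h (B t \<omega> - B s \<omega>))"
    "(\<integral>\<omega>. Z \<omega> * h (B t \<omega> - B s \<omega>) \<partial>P) = (\<integral>\<omega>. Z \<omega> \<partial>P) * (\<integral>\<omega>. h (B t \<omega> - B s \<omega>) \<partial>P)"
    using Z(2) h(2) by (auto intro: indep_var_integrable indep_var_lebesgue_integral)
qed

lemma brownian_motion_increment:
  assumes "brownian_motion P C B" "0 \<le> s" "s \<le> t"
  shows "centred_gaussian P ((t - s) *\<^sub>R C) (\<lambda>\<omega>. B t \<omega> - B s \<omega>)"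
  using assms by (simp add: brownian_motion_def)

lemma brownian_motion_second_moment:
  fixes B :: "real \<Rightarrow> 'b \<Rightarrow> real ^ 'd"
  assumes B: "brownian_motion P C B" and int: "integrable P (\<lambda>\<omega>. B 1 \<omega> \<otimes>\<^sub>v B 1 \<omega>)"
  shows "(\<integral>\<omega>. B 1 \<omega> \<otimes>\<^sub>v B 1 \<omega> \<partial>P) = C"
proof -
  interpret prob_space P
    using B by (simp add: brownian_motion_def)
  have [measurable]: "B 0 \<in> borel_measurable P" "B 1 \<in> borel_measurable P"
    using B by (auto simp: brownian_motion_def)
  have z: "AE \<omega> in P. B 0 \<omega> = 0"
    using B by (simp add: brownian_motion_def)
  have "(\<integral>\<omega>. B 1 \<omega> \<otimes>\<^sub>v B 1 \<omega> \<partial>P) $ i $ j = C $ i $ j" for i j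
  proof -
    have "(\<integral>\<omega>. B 1 \<omega> \<otimes>\<^sub>v B 1 \<omega> \<partial>P) $ i $ j = (\<integral>\<omega>. B 1 \<omega> $ i * B 1 \<omega> $ j \<partial>P)"
      using integrable_vec_nth[OF int, of i] integrable_vec_nth[of P "\<lambda>\<omega>. (B 1 \<omega> \<otimes>\<^sub>v B 1 \<omega>) $ i" j]
      by simp
    also have "\<dots> = (\<integral>\<omega>. (B 1 \<omega> - B 0 \<omega>) $ i * (B 1 \<omega> - B 0 \<omega>) $ j \<partial>P)"
      using z by (intro integral_cong_AE) auto
    also have "\<dots> = C $ i $ j"
      using centred_gaussian_moments(5)[OF brownian_motion_increment[OF B, of 0 1], of i j] by simp
    finally show ?thesis .
  qed
  then show ?thesis
    by (simp add: vec_eq_iff)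
qed

section \<open>Expectation of Ito integrals and of the rough path\<close>

text \<open>Each coefficient is determined by the past of its interval; the increment is centred and independent
  of that past, so every summand has expectation \<open>0\<close>.\<close>

lemma elementary_ito_expectation:
  fixes B :: "real \<Rightarrow> 'b \<Rightarrow> real ^ 'd"
  assumes B: "brownian_motion P C B"
    and el: "elementary_process P (nat_filtration P B) t n \<tau> \<phi>"
  shows "integrable P (elementary_ito (\<lambda>s \<omega>. B s \<omega> $ j) n \<tau> \<phi>)"
    and "(\<integral>\<omega>. elementary_ito (\<lambda>s \<omega>. B s \<omega> $ j) n \<tau> \<phi> \<omega> \<partial>P) = 0"
proof -
  interpret prob_space P
    using B by (simp add: brownian_motion_def)
  have m: "B t \<in> borel_measurable P" if "t \<ge> 0" for t
    using B that by (simp add: brownian_motion_def)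
  have p: "is_partition 0 t n \<tau>"
    using el by (simp add: elementary_process_def)
  have summand: "integrable P (\<lambda>\<omega>. \<phi> k \<omega> * (B (\<tau> (Suc k)) \<omega> $ j - B (\<tau> k) \<omega> $ j))
      \<and> (\<integral>\<omega>. \<phi> k \<omega> * (B (\<tau> (Suc k)) \<omega> $ j - B (\<tau> k) \<omega> $ j) \<partial>P) = 0" if "k < n" for k
  proof -
    have \<tau>: "0 \<le> \<tau> k" "\<tau> k \<le> \<tau> (Suc k)"
      using partition_in_interval[OF p, of k] partition_mono[OF p, of k "Suc k"] that by auto
    have \<phi>: "\<phi> k \<in> borel_measurable (nat_filtration P B (\<tau> k))" "integrable P (\<lambda>\<omega>. (\<phi> k \<omega>)\<^sup>2)"
      using el that by (auto simp: elementary_process_def)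
    have "\<phi> k \<in> borel_measurable P"
      using \<phi>(1) borel_measurable_nat_filtration[of B P, OF m] by blast
    then have int: "integrable P (\<phi> k)"
      using \<phi>(2) by (rule square_integrable_imp_integrable)
    have nth: "(\<lambda>x :: real ^ 'd. x $ j) \<in> borel_measurable borel"
      by simp
    note gauss = centred_gaussian_moments[OF brownian_motion_increment[OF B \<tau>]]
    have incr: "integrable P (\<lambda>\<omega>. (B (\<tau> (Suc k)) \<omega> - B (\<tau> k) \<omega>) $ j)"
      using gauss(1)[of j 1] by simp
    show ?thesis
      using brownian_motion_independent_increment[OF B \<tau> \<phi>(1) int nth incr] gauss(2)[of j] by simp
  qed
  show "integrable P (elementary_ito (\<lambda>s \<omega>. B s \<omega> $ j) n \<tau> \<phi>)"
    unfolding elementary_ito_def using summand by (intro Bochner_Integration.integrable_sum) simp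
  show "(\<integral>\<omega>. elementary_ito (\<lambda>s \<omega>. B s \<omega> $ j) n \<tau> \<phi> \<omega> \<partial>P) = 0"
    unfolding elementary_ito_def using summand
    by (subst Bochner_Integration.integral_sum) (auto intro!: sum.neutral)
qed

text \<open>The elementary integrals \<open>J m\<close> are centred and converge to \<open>I\<close> in mean square, and
  \<open>(E I)\<^sup>2 = (E (I - J m))\<^sup>2 \<le> E ((I - J m)\<^sup>2)\<close>.\<close>

lemma has_ito_integral_expectation:
  fixes B :: "real \<Rightarrow> 'b \<Rightarrow> real ^ 'd"
  assumes B: "brownian_motion P C B"
    and ito: "has_ito_integral P (nat_filtration P B) t H (\<lambda>s \<omega>. B s \<omega> $ j) I"
  shows "(\<integral>\<omega>. I \<omega> \<partial>P) = 0"
proof -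
  interpret prob_space P
    using B by (simp add: brownian_motion_def)
  have I[measurable]: "I \<in> borel_measurable P"
    using ito by (simp add: has_ito_integral_def)
  obtain n \<tau> \<phi> where el: "\<forall>m. elementary_process P (nat_filtration P B) t (n m) (\<tau> m) (\<phi> m)"
    and lim: "(\<lambda>m. \<integral>\<^sup>+ \<omega>. ennreal ((I \<omega> -
        elementary_ito (\<lambda>s \<omega>. B s \<omega> $ j) (n m) (\<tau> m) (\<phi> m) \<omega>)\<^sup>2) \<partial>P) \<longlonglongrightarrow> 0"
    using ito unfolding has_ito_integral_def by (elim exE conjE)
  define J where "J = (\<lambda>m. elementary_ito (\<lambda>s \<omega>. B s \<omega> $ j) (n m) (\<tau> m) (\<phi> m))"
  have J: "integrable P (J m)" "expectation (J m) = 0" for m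
    using elementary_ito_expectation[OF B el[rule_format, of m]] unfolding J_def by auto
  have [measurable]: "J m \<in> borel_measurable P" for m
    by (rule borel_measurable_integrable[OF J(1)])
  let ?e = "\<lambda>m. \<integral>\<^sup>+ \<omega>. ennreal ((I \<omega> - J m \<omega>)\<^sup>2) \<partial>P"
  have lim': "?e \<longlonglongrightarrow> 0"
    using lim unfolding J_def .
  have bound: "ennreal ((expectation I)\<^sup>2) \<le> ?e m" if "?e m < \<infinity>" for m
  proof -
    have sq: "integrable P (\<lambda>\<omega>. (I \<omega> - J m \<omega>)\<^sup>2)"
      using that by (intro integrableI_nonneg) auto
    have int: "integrable P (\<lambda>\<omega>. I \<omega> - J m \<omega>)"
      by (rule square_integrable_imp_integrable[OF _ sq]) measurable
    have mean: "expectation I = expectation (\<lambda>\<omega>. I \<omega> - J m \<omega>)"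
      using Bochner_Integration.integral_add[OF int J(1)[of m]] by (simp add: J(2))
    have "(expectation I)\<^sup>2 \<le> expectation (\<lambda>\<omega>. (I \<omega> - J m \<omega>)\<^sup>2)"
      using variance_eq[OF int sq] variance_positive[of "\<lambda>\<omega>. I \<omega> - J m \<omega>"]
      unfolding mean by linarith
    then show ?thesis
      by (subst nn_integral_eq_integral[OF sq]) (auto intro: ennreal_leI)
  qed
  have "\<forall>\<^sub>F m in sequentially. ?e m < \<infinity>"
    using lim' by (rule order_tendstoD) simp
  then have "\<forall>\<^sub>F m in sequentially. ennreal ((expectation I)\<^sup>2) \<le> ?e m"
    by eventually_elim (rule bound)
  then have "ennreal ((expectation I)\<^sup>2) \<le> 0"
    by (rule tendsto_lowerbound[OF lim']) simp
  then show ?thesis by simp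
qed

lemma brownian_rough_path_ito:
  assumes "brownian_rough_path P C \<Gamma> B BB" and "t \<ge> 0"
  shows "has_ito_integral P (nat_filtration P B) t (\<lambda>s \<omega>. B s \<omega> $ i) (\<lambda>s \<omega>. B s \<omega> $ j)
    (\<lambda>\<omega>. BB t \<omega> $ i $ j - t * \<Gamma> $ i $ j)"
  using assms by (simp add: brownian_rough_path_def)

lemma brownian_rough_path_expectation:
  fixes B :: "real \<Rightarrow> 'b \<Rightarrow> real ^ 'd"
  assumes rp: "brownian_rough_path P C \<Gamma> B BB" and int: "integrable P (BB 1)"
  shows "(\<integral>\<omega>. BB 1 \<omega> \<partial>P) = \<Gamma>"
proof -
  have B: "brownian_motion P C B"
    using rp by (simp add: brownian_rough_path_def)
  interpret prob_space P
    using B by (simp add: brownian_motion_def)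
  have "(\<integral>\<omega>. BB 1 \<omega> \<partial>P) $ i $ j = \<Gamma> $ i $ j" for i j
  proof -
    note i = integrable_vec_nth[OF int, of i]
    note ij = integrable_vec_nth[OF i(1), of j]
    have "has_ito_integral P (nat_filtration P B) 1 (\<lambda>s \<omega>. B s \<omega> $ i) (\<lambda>s \<omega>. B s \<omega> $ j)
        (\<lambda>\<omega>. BB 1 \<omega> $ i $ j - 1 * \<Gamma> $ i $ j)"
      by (rule brownian_rough_path_ito[OF rp]) simp
    from has_ito_integral_expectation[OF B this] show ?thesis
      using i ij by (simp add: prob_space)
  qed
  then show ?thesis
    by (simp add: vec_eq_iff)
qed

section \<open>Covariation of Brownian motion\<close>

text \<open>The centred products of increments are uncorrelated, because each is centred and independent of the
  past, which contains the earlier ones. So their variances add, and a fourth moment bound for a single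
  increment makes each of them of the order of the squared length of its interval. Measurability of the
  partial sums with respect to the past is part of the induction, since the next step needs it.\<close>

lemma brownian_covariation_variance:
  fixes B :: "real \<Rightarrow> 'b \<Rightarrow> real ^ 'd" and i j :: 'd
  assumes B: "brownian_motion P C B" and p: "is_partition 0 t n \<tau>" and "l \<le> n"
  defines "Z \<equiv> \<lambda>k \<omega>. (B (\<tau> (Suc k)) \<omega> $ i - B (\<tau> k) \<omega> $ i) * (B (\<tau> (Suc k)) \<omega> $ j - B (\<tau> k) \<omega> $ j)
      - (\<tau> (Suc k) - \<tau> k) * C $ i $ j"
  shows "(\<lambda>\<omega>. \<Sum>k<l. Z k \<omega>) \<in> borel_measurable (nat_filtration P B (\<tau> l)) \<and>
    integrable P (\<lambda>\<omega>. (\<Sum>k<l. Z k \<omega>)\<^sup>2) \<and>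
    (\<integral>\<omega>. (\<Sum>k<l. Z k \<omega>)\<^sup>2 \<partial>P) \<le>
      (3 / 2) * ((C $ i $ i)\<^sup>2 + (C $ j $ j)\<^sup>2) * (\<Sum>k<l. (\<tau> (Suc k) - \<tau> k)\<^sup>2)"
  using \<open>l \<le> n\<close>
proof (induction l)
  case (Suc l)
  interpret prob_space P
    using B by (simp add: brownian_motion_def)
  have m: "B t \<in> borel_measurable P" if "t \<ge> 0" for t
    using B that by (simp add: brownian_motion_def)
  define S where "S = (\<lambda>\<omega>. \<Sum>k<l. Z k \<omega>)"
  let ?K = "(3 / 2) * ((C $ i $ i)\<^sup>2 + (C $ j $ j)\<^sup>2)"
  have S: "S \<in> borel_measurable (nat_filtration P B (\<tau> l))" "integrable P (\<lambda>\<omega>. (S \<omega>)\<^sup>2)"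
    "expectation (\<lambda>\<omega>. (S \<omega>)\<^sup>2) \<le> ?K * (\<Sum>k<l. (\<tau> (Suc k) - \<tau> k)\<^sup>2)"
    using Suc unfolding S_def by auto
  have \<tau>: "0 \<le> \<tau> l" "\<tau> l \<le> \<tau> (Suc l)" "0 \<le> \<tau> (Suc l)"
    using partition_in_interval[OF p, of l] partition_in_interval[OF p, of "Suc l"]
      partition_mono[OF p, of l "Suc l"] Suc.prems by auto
  define \<Delta> where "\<Delta> = \<tau> (Suc l) - \<tau> l"
  define h where "h = (\<lambda>x :: real ^ 'd. x $ i * x $ j - \<Delta> * C $ i $ j)"
  have Z: "Z l = (\<lambda>\<omega>. h (B (\<tau> (Suc l)) \<omega> - B (\<tau> l) \<omega>))"
    by (simp add: Z_def h_def \<Delta>_def)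
  have h[measurable]: "h \<in> borel_measurable borel"
    unfolding h_def by measurable
  define D where "D = (\<lambda>\<omega>. B (\<tau> (Suc l)) \<omega> - B (\<tau> l) \<omega>)"
  have Dm[measurable]: "D \<in> borel_measurable P"
    unfolding D_def using m \<tau> by simp
  have "centred_gaussian P (\<Delta> *\<^sub>R C) D"
    using brownian_motion_increment[OF B \<tau>(1,2)] by (simp add: D_def \<Delta>_def)
  note gauss = centred_gaussian_moments[OF this]
  \<comment> \<open>Fourth moments of single coordinates suffice, since \<open>2 * x\<^sup>2 * y\<^sup>2 \<le> x ^ 4 + y ^ 4\<close>.\<close>
  have prod_sq_le: "(D \<omega> $ i * D \<omega> $ j)\<^sup>2 \<le> ((D \<omega> $ i) ^ 4 + (D \<omega> $ j) ^ 4) / 2" for \<omega>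
    using sum_squares_bound[of "(D \<omega> $ i)\<^sup>2" "(D \<omega> $ j)\<^sup>2"] by (simp add: power_mult_distrib)
  have prod_sq: "integrable P (\<lambda>\<omega>. (D \<omega> $ i * D \<omega> $ j)\<^sup>2)"
    by (rule Bochner_Integration.integrable_bound[of _ "\<lambda>\<omega>. ((D \<omega> $ i) ^ 4 + (D \<omega> $ j) ^ 4) / 2"])
      (use gauss(1)[of i 4] gauss(1)[of j 4] prod_sq_le in auto)
  have Z_mean: "integrable P (Z l)" "expectation (Z l) = 0"
    unfolding Z h_def D_def[symmetric] using gauss(4)[of i j] gauss(5)[of i j]
    by (simp_all add: D_def prob_space)
  have Z_sq_eq: "(Z l \<omega>)\<^sup>2 = (D \<omega> $ i * D \<omega> $ j)\<^sup>2 - 2 * (\<Delta> * C $ i $ j) * (D \<omega> $ i * D \<omega> $ j)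
      + (\<Delta> * C $ i $ j)\<^sup>2" for \<omega>
    by (simp add: Z h_def D_def power2_diff)
  have Z_sq: "integrable P (\<lambda>\<omega>. (Z l \<omega>)\<^sup>2)"
    unfolding Z_sq_eq using prod_sq gauss(4)[of i j] by simp
  have "expectation (\<lambda>\<omega>. (Z l \<omega>)\<^sup>2) = expectation (\<lambda>\<omega>. (D \<omega> $ i * D \<omega> $ j)\<^sup>2) - (\<Delta> * C $ i $ j)\<^sup>2"
    unfolding Z_sq_eq using prod_sq gauss(4)[of i j] gauss(5)[of i j]
    by (simp add: prob_space power2_eq_square)
  also have "\<dots> \<le> expectation (\<lambda>\<omega>. (D \<omega> $ i * D \<omega> $ j)\<^sup>2)"
    by simp
  also have "\<dots> \<le> expectation (\<lambda>\<omega>. ((D \<omega> $ i) ^ 4 + (D \<omega> $ j) ^ 4) / 2)"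
    using gauss(1)[of i 4] gauss(1)[of j 4] prod_sq prod_sq_le by (intro integral_mono) auto
  also have "\<dots> = ?K * \<Delta>\<^sup>2"
    using gauss(1)[of i 4] gauss(1)[of j 4] gauss(3)[of i] gauss(3)[of j]
    by (simp add: power_mult_distrib algebra_simps)
  finally have Z_var: "expectation (\<lambda>\<omega>. (Z l \<omega>)\<^sup>2) \<le> ?K * \<Delta>\<^sup>2" .
  have "S \<in> borel_measurable P"
    using S(1) borel_measurable_nat_filtration[of B P, OF m] by blast
  then have S_int: "integrable P S"
    using S(2) by (rule square_integrable_imp_integrable)
  have cross: "integrable P (\<lambda>\<omega>. S \<omega> * Z l \<omega>)" "expectation (\<lambda>\<omega>. S \<omega> * Z l \<omega>) = 0"
    using brownian_motion_independent_increment[OF B \<tau>(1,2) S(1) S_int h] Z_mean unfolding Z by auto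
  have sq: "(\<Sum>k<Suc l. Z k \<omega>)\<^sup>2 = (S \<omega>)\<^sup>2 + 2 * (S \<omega> * Z l \<omega>) + (Z l \<omega>)\<^sup>2" for \<omega>
    by (simp add: S_def power2_sum)
  have "integrable P (\<lambda>\<omega>. (\<Sum>k<Suc l. Z k \<omega>)\<^sup>2)"
    unfolding sq using S(2) cross(1) Z_sq by simp
  moreover have "expectation (\<lambda>\<omega>. (\<Sum>k<Suc l. Z k \<omega>)\<^sup>2) =
      expectation (\<lambda>\<omega>. (S \<omega>)\<^sup>2) + expectation (\<lambda>\<omega>. (Z l \<omega>)\<^sup>2)"
    unfolding sq using S(2) cross Z_sq by simp
  then have "expectation (\<lambda>\<omega>. (\<Sum>k<Suc l. Z k \<omega>)\<^sup>2) \<le> ?K * (\<Sum>k<Suc l. (\<tau> (Suc k) - \<tau> k)\<^sup>2)"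
    using S(3) Z_var by (simp add: \<Delta>_def distrib_left)
  moreover have "(\<lambda>\<omega>. \<Sum>k<Suc l. Z k \<omega>) \<in> borel_measurable (nat_filtration P B (\<tau> (Suc l)))"
  proof -
    have "B (\<tau> l) \<in> borel_measurable (nat_filtration P B (\<tau> (Suc l)))"
      "B (\<tau> (Suc l)) \<in> borel_measurable (nat_filtration P B (\<tau> (Suc l)))"
      using \<tau> by (auto intro: nat_filtration_measurable)
    then have "Z l \<in> borel_measurable (nat_filtration P B (\<tau> (Suc l)))"
      unfolding Z by (intro measurable_compose[OF _ h] borel_measurable_diff)
    moreover have "S \<in> borel_measurable (nat_filtration P B (\<tau> (Suc l)))"
      using S(1) nat_filtration_mono[OF \<tau>(2), of P B] by blast
    ultimately show ?thesis
      unfolding sum.lessThan_Suc by (simp add: S_def)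
  qed
  ultimately show ?case by simp
qed simp

text \<open>On a partition of mesh \<open>\<delta>\<close> the squared interval lengths add up to at most \<open>\<delta> * t\<close>, so the sums of
  products converge in mean square, hence in probability.\<close>

lemma brownian_motion_covariation:
  fixes B :: "real \<Rightarrow> 'b \<Rightarrow> real ^ 'd"
  assumes B: "brownian_motion P C B" and "t \<ge> 0"
  shows "has_covariation P t (\<lambda>s \<omega>. B s \<omega> $ i) (\<lambda>s \<omega>. B s \<omega> $ j) (\<lambda>_. t * C $ i $ j)"
  unfolding has_covariation_def tendsto_in_prob_def
proof (intro allI impI conjI)
  fix n :: "nat \<Rightarrow> nat" and \<tau> :: "nat \<Rightarrow> nat \<Rightarrow> real"
  assume A: "(\<forall>m. is_partition 0 t (n m) (\<tau> m)) \<and>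
    (\<forall>\<delta>>0. \<forall>\<^sub>F m in sequentially. mesh_less \<delta> (n m) (\<tau> m))"
  interpret prob_space P
    using B by (simp add: brownian_motion_def)
  have p: "is_partition 0 t (n m) (\<tau> m)" for m
    using A by simp
  have meas: "B s \<in> borel_measurable P" if "s \<ge> 0" for s
    using B that by (simp add: brownian_motion_def)
  define X where "X = (\<lambda>m \<omega>. \<Sum>k<n m. (B (\<tau> m (Suc k)) \<omega> $ i - B (\<tau> m k) \<omega> $ i) *
    (B (\<tau> m (Suc k)) \<omega> $ j - B (\<tau> m k) \<omega> $ j))"
  let ?q = "t * C $ i $ j"
  let ?K = "(3 / 2) * ((C $ i $ i)\<^sup>2 + (C $ j $ j)\<^sup>2)"
  have centred: "X m \<omega> - ?q = (\<Sum>k<n m. (B (\<tau> m (Suc k)) \<omega> $ i - B (\<tau> m k) \<omega> $ i) *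
    (B (\<tau> m (Suc k)) \<omega> $ j - B (\<tau> m k) \<omega> $ j) - (\<tau> m (Suc k) - \<tau> m k) * C $ i $ j)" for m \<omega>
    using partition_sum_increments[OF p[of m], of id]
    by (simp add: X_def sum_subtractf flip: sum_distrib_right)
  note var = brownian_covariation_variance[OF B p order_refl, where i = i and j = j, folded centred]
  have X: "X m \<in> borel_measurable P" for m
  proof -
    have "(\<lambda>\<omega>. X m \<omega> - ?q) \<in> borel_measurable P"
      using var[of m] borel_measurable_nat_filtration[of B P, OF meas] by blast
    then have "(\<lambda>\<omega>. (X m \<omega> - ?q) + ?q) \<in> borel_measurable P"
      by (intro borel_measurable_add) auto
    then show ?thesis by simp
  qed
  then show "(\<lambda>\<omega>. \<Sum>k<n m. (B (\<tau> m (Suc k)) \<omega> $ i - B (\<tau> m k) \<omega> $ i) *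
    (B (\<tau> m (Suc k)) \<omega> $ j - B (\<tau> m k) \<omega> $ j)) \<in> borel_measurable P" for m
    unfolding X_def by simp
  show "(\<lambda>_. ?q) \<in> borel_measurable P" by simp
  fix \<epsilon> :: real
  assume \<epsilon>: "\<epsilon> > 0"
  have var_le: "expectation (\<lambda>\<omega>. (X m \<omega> - ?q)\<^sup>2) \<le> ?K * (\<delta> * t)" if "mesh_less \<delta> (n m) (\<tau> m)" for m \<delta>
  proof -
    have "(\<Sum>k<n m. (\<tau> m (Suc k) - \<tau> m k)\<^sup>2) \<le> (\<Sum>k<n m. \<delta> * (\<tau> m (Suc k) - \<tau> m k))"
      unfolding power2_eq_square using that p[of m]
      by (intro sum_mono mult_right_mono) (auto simp: mesh_less_def is_partition_def intro: less_imp_le)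
    also have "\<dots> = \<delta> * t"
      using partition_sum_increments[OF p[of m], of id] by (simp flip: sum_distrib_left)
    finally have "?K * (\<Sum>k<n m. (\<tau> m (Suc k) - \<tau> m k)\<^sup>2) \<le> ?K * (\<delta> * t)"
      by (intro mult_left_mono) auto
    then show ?thesis
      using var[of m] by linarith
  qed
  have "(\<lambda>m. expectation (\<lambda>\<omega>. (X m \<omega> - ?q)\<^sup>2)) \<longlonglongrightarrow> 0"
  proof (rule order_tendstoI)
    fix a :: real assume "a < 0"
    then show "\<forall>\<^sub>F m in sequentially. a < expectation (\<lambda>\<omega>. (X m \<omega> - ?q)\<^sup>2)"
      by (intro always_eventually allI) (rule less_le_trans, assumption, simp)
  next
    fix a :: real assume "0 < a"
    \<comment> \<open>The summand \<open>1\<close> keeps the denominator positive when \<open>?K * t = 0\<close>.\<close>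
    define \<delta> where "\<delta> = a / (?K * t + 1)"
    have Kt: "?K * t \<ge> 0"
      using \<open>t \<ge> 0\<close> by simp
    then have "\<delta> > 0"
      using \<open>0 < a\<close> by (simp add: \<delta>_def)
    have "\<delta> * (?K * t + 1) = a"
      using Kt by (simp add: \<delta>_def)
    then have "?K * (\<delta> * t) < a"
      using \<open>\<delta> > 0\<close> by (simp add: algebra_simps)
    moreover have "\<forall>\<^sub>F m in sequentially. mesh_less \<delta> (n m) (\<tau> m)"
      using A \<open>\<delta> > 0\<close> by simp
    ultimately show "\<forall>\<^sub>F m in sequentially. expectation (\<lambda>\<omega>. (X m \<omega> - ?q)\<^sup>2) < a"
      by (elim eventually_mono) (rule le_less_trans[OF var_le], assumption+)
  qed
  then have lim: "(\<lambda>m. expectation (\<lambda>\<omega>. (X m \<omega> - ?q)\<^sup>2) / \<epsilon>\<^sup>2) \<longlonglongrightarrow> 0"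
    using tendsto_mult_left_zero[of _ sequentially "inverse (\<epsilon>\<^sup>2)"] by (simp add: divide_inverse)
  have "(\<lambda>m. prob {\<omega> \<in> space P. \<bar>X m \<omega> - ?q\<bar> > \<epsilon>}) \<longlonglongrightarrow> 0"
  proof (rule tendsto_sandwich[OF _ _ tendsto_const lim])
    have "prob {\<omega> \<in> space P. \<bar>X m \<omega> - ?q\<bar> > \<epsilon>} \<le> expectation (\<lambda>\<omega>. (X m \<omega> - ?q)\<^sup>2) / \<epsilon>\<^sup>2" for m
    proof -
      have "prob {\<omega> \<in> space P. \<bar>X m \<omega> - ?q\<bar> > \<epsilon>} \<le> prob {\<omega> \<in> space P. \<bar>X m \<omega> - ?q\<bar> \<ge> \<epsilon>}"
        using X[of m] by (intro finite_measure_mono) auto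
      also have "\<dots> \<le> expectation (\<lambda>\<omega>. (X m \<omega> - ?q)\<^sup>2) / \<epsilon>\<^sup>2"
        using X[of m] var[of m] \<epsilon> by (intro second_moment_method) auto
      finally show ?thesis .
    qed
    then show "\<forall>\<^sub>F m in sequentially. prob {\<omega> \<in> space P. \<bar>X m \<omega> - ?q\<bar> > \<epsilon>}
        \<le> expectation (\<lambda>\<omega>. (X m \<omega> - ?q)\<^sup>2) / \<epsilon>\<^sup>2"
      by simp
  qed simp
  then show "(\<lambda>m. prob {\<omega> \<in> space P. \<bar>(\<Sum>k<n m. (B (\<tau> m (Suc k)) \<omega> $ i - B (\<tau> m k) \<omega> $ i) *
    (B (\<tau> m (Suc k)) \<omega> $ j - B (\<tau> m k) \<omega> $ j)) - ?q\<bar> > \<epsilon>}) \<longlonglongrightarrow> 0"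
    unfolding X_def .
qed

section \<open>The characteristics of the limit\<close>

theorem theorem2:
  fixes M :: "'a measure" and P :: "'b measure"
    and \<xi> :: "nat \<Rightarrow> 'a \<Rightarrow> real ^ 'd"
    and B :: "real \<Rightarrow> 'b \<Rightarrow> real ^ 'd"
    and BB :: "real \<Rightarrow> 'b \<Rightarrow> real ^ 'd ^ 'd"
  assumes "prob_space M" and "prob_space P"
    and "stationary_process M \<xi>"
    and "integrable M (\<lambda>\<omega>. (norm (\<xi> 0 \<omega>))\<^sup>2)"
    and "(\<integral>\<omega>. \<xi> 0 \<omega> \<partial>M) = 0"
    and "summable (\<lambda>n. correlation M \<xi> (Suc n))"
    and "\<exists>\<Sigma>0 \<Gamma>0. brownian_rough_path P \<Sigma>0 \<Gamma>0 B BB"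
    and "iterated_invariance_principle M (linear_partial_sum \<xi>)
           (\<lambda>N. canonical_lift (linear_partial_sum \<xi> N)) P B BB"
  shows "brownian_rough_path P
           (correlation M \<xi> 0 + 2 *\<^sub>R sym_part (\<Sum>n. correlation M \<xi> (Suc n)))
           ((1/2) *\<^sub>R correlation M \<xi> 0 + (\<Sum>n. correlation M \<xi> (Suc n))) B BB \<and>
         (\<exists>Strat :: 'b \<Rightarrow> real ^ 'd ^ 'd.
            (\<forall>i j. has_stratonovich_integral P (nat_filtration P B) 1
               (\<lambda>s \<omega>. B s \<omega> $ i) (\<lambda>s \<omega>. B s \<omega> $ j) (\<lambda>\<omega>. Strat \<omega> $ i $ j)) \<and>
            (AE \<omega> in P. BB 1 \<omega> = Strat \<omega> + anti_part (\<Sum>n. correlation M \<xi> (Suc n))))"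
proof -
  note \<xi> = assms(3,4)
  define D where "D = (\<Sum>n. correlation M \<xi> (Suc n))"
  define \<Gamma> where "\<Gamma> = (1/2) *\<^sub>R correlation M \<xi> 0 + D"
  define C where "C = correlation M \<xi> 0 + 2 *\<^sub>R sym_part D"
  \<comment> \<open>The claimed covariance is twice the symmetric part of the claimed \<open>\<Gamma>\<close>.\<close>
  have C: "C = \<Gamma> + transpose \<Gamma>"
    using transpose_correlation_0[OF \<xi>]
    by (simp add: C_def \<Gamma>_def sym_part_def vec_eq_iff algebra_simps)
  obtain C' \<Gamma>' where rp': "brownian_rough_path P C' \<Gamma>' B BB"
    using assms(7) by blast
  let ?S = "\<lambda>N. linear_partial_sum \<xi> N 1" and ?SS = "\<lambda>N. canonical_lift (linear_partial_sum \<xi> N) 1"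
  have iip: "\<And>N. N \<ge> 1 \<Longrightarrow> integrable M (?SS N)"
    "integrable P (\<lambda>\<omega>. B 1 \<omega> \<otimes>\<^sub>v B 1 \<omega>)" "integrable P (BB 1)"
    "(\<lambda>N. \<integral>\<omega>. ?S N \<omega> \<otimes>\<^sub>v ?S N \<omega> \<partial>M) \<longlonglongrightarrow> (\<integral>\<omega>. B 1 \<omega> \<otimes>\<^sub>v B 1 \<omega> \<partial>P)"
    "(\<lambda>N. \<integral>\<omega>. ?SS N \<omega> \<partial>M) \<longlonglongrightarrow> (\<integral>\<omega>. BB 1 \<omega> \<partial>P)"
    using assms(8) by (auto simp: iterated_invariance_principle_def)
  have lift: "(\<lambda>N. \<integral>\<omega>. ?SS N \<omega> \<partial>M) \<longlonglongrightarrow> \<Gamma>"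
    unfolding \<Gamma>_def D_def by (rule integral_canonical_lift_tendsto[OF \<xi> assms(6)])
  have "\<Gamma>' = \<Gamma>"
    using LIMSEQ_unique[OF lift iip(5)] brownian_rough_path_expectation[OF rp' iip(3)] by simp
  have "(\<lambda>N. \<integral>\<omega>. ?S N \<omega> \<otimes>\<^sub>v ?S N \<omega> \<partial>M) \<longlonglongrightarrow> C"
  proof (rule Lim_transform_eventually)
    show "(\<lambda>N. (\<integral>\<omega>. ?SS N \<omega> \<partial>M) + transpose (\<integral>\<omega>. ?SS N \<omega> \<partial>M)) \<longlonglongrightarrow> C"
      unfolding C by (intro tendsto_add lift bounded_linear.tendsto[OF bounded_linear_transpose])
    have "(\<integral>\<omega>. ?SS N \<omega> \<partial>M) + transpose (\<integral>\<omega>. ?SS N \<omega> \<partial>M) = (\<integral>\<omega>. ?S N \<omega> \<otimes>\<^sub>v ?S N \<omega> \<partial>M)"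
      if "N \<ge> 1" for N
      using integral_bounded_linear[OF bounded_linear_transpose iip(1)[OF that]]
        integrable_bounded_linear[OF bounded_linear_transpose iip(1)[OF that]] iip(1)[OF that]
      by (simp add: outer_linear_partial_sum)
    then show "\<forall>\<^sub>F N in sequentially. (\<integral>\<omega>. ?SS N \<omega> \<partial>M) + transpose (\<integral>\<omega>. ?SS N \<omega> \<partial>M) =
        (\<integral>\<omega>. ?S N \<omega> \<otimes>\<^sub>v ?S N \<omega> \<partial>M)"
      by (rule eventually_sequentiallyI[of 1])
  qed
  from LIMSEQ_unique[OF this iip(4)] have "C' = C"
    using brownian_motion_second_moment[of P C' B, OF _ iip(2)] rp'
    by (simp add: brownian_rough_path_def)
  have rp: "brownian_rough_path P C \<Gamma> B BB"
    using rp' by (simp add: \<open>\<Gamma>' = \<Gamma>\<close> \<open>C' = C\<close>)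
  then have B: "brownian_motion P C B"
    by (simp add: brownian_rough_path_def)
  \<comment> \<open>The Stratonovich integral adds half the covariation \<open>C\<close>, that is the symmetric part of \<open>\<Gamma>\<close>, to the
    Ito integral \<open>BB 1 - \<Gamma>\<close>. What remains of \<open>\<Gamma>\<close> is its antisymmetric part, which is that of \<open>D\<close>.\<close>
  define Strat where "Strat = (\<lambda>\<omega>. BB 1 \<omega> - anti_part D)"
  have "has_stratonovich_integral P (nat_filtration P B) 1
      (\<lambda>s \<omega>. B s \<omega> $ i) (\<lambda>s \<omega>. B s \<omega> $ j) (\<lambda>\<omega>. Strat \<omega> $ i $ j)" for i j
    unfolding has_stratonovich_integral_def
  proof (intro conjI exI)
    have "BB 1 \<in> borel_measurable P"
      using rp by (simp add: brownian_rough_path_def)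
    then show "(\<lambda>\<omega>. Strat \<omega> $ i $ j) \<in> borel_measurable P"
      unfolding Strat_def by measurable
    show "has_ito_integral P (nat_filtration P B) 1 (\<lambda>s \<omega>. B s \<omega> $ i) (\<lambda>s \<omega>. B s \<omega> $ j)
        (\<lambda>\<omega>. BB 1 \<omega> $ i $ j - 1 * \<Gamma> $ i $ j)"
      by (rule brownian_rough_path_ito[OF rp]) simp
    show "has_covariation P 1 (\<lambda>s \<omega>. B s \<omega> $ i) (\<lambda>s \<omega>. B s \<omega> $ j) (\<lambda>_. 1 * C $ i $ j)"
      by (rule brownian_motion_covariation[OF B]) simp
    have "anti_part D $ i $ j = \<Gamma> $ i $ j - C $ i $ j / 2"
      by (simp add: anti_part_def C_def \<Gamma>_def sym_part_def field_simps)
    then show "AE \<omega> in P. Strat \<omega> $ i $ j = BB 1 \<omega> $ i $ j - 1 * \<Gamma> $ i $ j + 1 * C $ i $ j / 2"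
      by (simp add: Strat_def)
  qed
  moreover have "AE \<omega> in P. BB 1 \<omega> = Strat \<omega> + anti_part D"
    by (simp add: Strat_def)
  ultimately show ?thesis
    using rp unfolding C_def \<Gamma>_def D_def by blast
qed

end
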